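(* Let $p$ be a constant and $C=\frac{16}{15}$. Any $p$-pass streaming algorithm in the row-arrival model that outputs a $C^k$-approximation to the $(2k)$-volume maximization problem with probability at least $\frac89$ requires $\Omega(n)$ bits of space.
   Context: Row-arrival model: the stream consists of the $n$ rows of a matrix $A\in\mathbb{R}^{n\times d}$ (entries integers bounded by $\mathrm{poly}(n)$), one row per update, in an adversarially chosen order; a $p$-pass algorithm reads the stream $p$ times in the same order. The $(2k)$-volume maximization problem: choose $2k$ rows of $A$ maximizing the volume $\sqrt{\det(SS^\top)}$ of the parallelepiped they span ($S$ the $2k\times d$ matrix of chosen rows). A $C^k$-approximation outputs $2k$ rows whose volume times $C^k$ is at least the maximum volume. *)

theory Defs
  imports
    "Jordan_Normal_Form.Determinant"
    "HOL-Probability.Probability_Mass_Function"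
begin

definition chosen_rows :: "int mat \<Rightarrow> nat list \<Rightarrow> int mat" where
  "chosen_rows A js = mat_of_rows (dim_col A) (map (Matrix.row A) js)"

definition volume :: "int mat \<Rightarrow> nat list \<Rightarrow> real" where
  "volume A js =
     (let S = chosen_rows A js in sqrt (of_int (Determinant.det (S * transpose_mat S))))"

definition row_choices :: "nat \<Rightarrow> nat \<Rightarrow> nat list set" where
  "row_choices n m = {js. length js = m \<and> distinct js \<and> set js \<subseteq> {..<n}}"

(* Junk value if A has fewer than m rows, because then there is no choice of m rows. *)
definition max_volume :: "int mat \<Rightarrow> nat \<Rightarrow> real" where
  "max_volume A m = Max (volume A ` row_choices (dim_row A) m)"

definition bounded_int_mats :: "nat \<Rightarrow> nat \<Rightarrow> nat \<Rightarrow> int mat set" where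
  "bounded_int_mats n d B =
     {A \<in> carrier_mat n d. \<forall>i<n. \<forall>j<d. \<bar>A $$ (i, j)\<bar> \<le> int B}"

(* A row can be output either by its position in the stream or by its entries, so that
   algorithms of both kinds are covered. *)
datatype row_ref = Position nat | Entries "int Matrix.vec"

fun refers_to :: "int mat \<Rightarrow> row_ref \<Rightarrow> nat \<Rightarrow> bool" where
  "refers_to A (Position i) j \<longleftrightarrow> i = j"
| "refers_to A (Entries v) j \<longleftrightarrow> v = Matrix.row A j"

(* update D q i r m: the memory after reading r as the i-th row in pass q with memory m.
   The algorithm may depend on q and i, neither of which is charged to its memory. *)
record streaming_alg =
  initial :: "bool list"
  update :: "nat \<Rightarrow> nat \<Rightarrow> int Matrix.vec \<Rightarrow> bool list \<Rightarrow> bool list"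
  answer :: "bool list \<Rightarrow> row_ref list"

definition run_pass :: "streaming_alg \<Rightarrow> int mat \<Rightarrow> nat \<Rightarrow> bool list \<Rightarrow> bool list" where
  "run_pass D A q = fold (\<lambda>i. update D q i (Matrix.row A i)) [0..<dim_row A]"

definition run :: "streaming_alg \<Rightarrow> nat \<Rightarrow> int mat \<Rightarrow> row_ref list" where
  "run D p A = answer D (fold (run_pass D A) [0..<p] (initial D))"

(* A randomized algorithm is a probability distribution over deterministic ones: all coin
   tosses, also those made during the stream, are drawn in advance and can be consulted at
   any time without being charged to the memory. *)
type_synonym randomized_alg = "streaming_alg pmf"

definition uses_bits :: "randomized_alg \<Rightarrow> nat \<Rightarrow> bool" where
  "uses_bits R s \<longleftrightarrow>
     (\<forall>D\<in>set_pmf R. length (initial D) = s \<and>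
        (\<forall>q i r m. length m = s \<longrightarrow> length (update D q i r m) = s))"

definition approx_output :: "int mat \<Rightarrow> nat \<Rightarrow> real \<Rightarrow> row_ref list \<Rightarrow> bool" where
  "approx_output A m \<alpha> rs \<longleftrightarrow>
     (\<exists>js\<in>row_choices (dim_row A) m.
        list_all2 (refers_to A) rs js \<and> max_volume A m \<le> \<alpha> * volume A js)"

definition solves_volume_max ::
  "randomized_alg \<Rightarrow> nat \<Rightarrow> int mat set \<Rightarrow> nat \<Rightarrow> real \<Rightarrow> real \<Rightarrow> bool" where
  "solves_volume_max R p \<A> m \<alpha> \<delta> \<longleftrightarrow>
     (\<forall>A\<in>\<A>. measure_pmf.prob R {D. approx_output A m \<alpha> (run D p A)} \<ge> \<delta>)"

end

(* Split the rows between Alice, who holds e_(j mod k) + e_(j, x_j) for j < N, and Bob, who holds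
   e_(j mod k) - e_(j, y_j). Two rows have inner product 1 if their indices agree modulo k,
   unless they carry the same index j and x_j = y_j; such a hit is orthogonal. If every residue
   class contains a planted hit, then some 2k rows have Gram determinant 4^k, whereas 2k rows with
   h hits have Gram determinant at most 4^k (3/4)^(k - h), so a (16/15)^k-approximation names at
   least k/2 hits.

   A p-pass algorithm with s bits partitions the pairs (x, y) into at most 2^(2ps) rectangles. By
   subadditivity of entropy and the cut-and-paste property of the Hellinger distance, planting one
   more hit at a typical index hardly changes the distribution of the transcript if s is a small
   fraction of N. Planting a second hit in a class and removing the first one moves the hit to an
   independent position, so an output naming 2k rows contains only few planted hits. *)

theory Submission
  imports Defs
begin

section \<open>Entropy and planted coincidences\<close>

text \<open>The distributions with and without all \<open>k\<close> planted hits are never compared;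
  that would take \<open>k\<close> successive changes of the transcript distribution. Every exchange
  of a single hit starts from a full transversal and costs a small constant on average, so the
  \<open>k\<close> losses add up to a small fraction of \<open>k\<close>. This is affordable because
  success demands a number of named hits proportional to \<open>k\<close>. The planted letters come
  from a shared uniform word. Each player's own word therefore stays uniform, and a hit shows only
  in the correlation of the two words. An alphabet much larger than \<open>N\<close> makes
  accidental hits rare, so a successful output must name mostly planted ones. The ratio 16/15 enters
  through (16/15)^4 < 4/3: with fewer than \<open>k/2\<close> hits the squared volume loses more
  than a factor (4/3)^(k/2), which the squared approximation factor cannot make up for. Coin tosses
  are removed by averaging over the instances, so everything about transcripts concerns one
  deterministic algorithm.\<close>

locale code_space =
  fixes N Q :: nat
  assumes Q_pos: "Q > 0"
begin

definition cube :: "(nat \<Rightarrow> nat) set" where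
  "cube = PiE {..<N} (\<lambda>_. {..<Q})"

definition mean :: "((nat \<Rightarrow> nat) \<Rightarrow> real) \<Rightarrow> real" where
  "mean f = (\<Sum>x\<in>cube. f x) / card cube"

definition avg :: "(nat \<Rightarrow> real) \<Rightarrow> real" where
  "avg g = (\<Sum>q<Q. g q) / Q"

text \<open>The conditional expectation of \<open>a\<close> given letter \<open>q\<close> at
  coordinate \<open>j\<close>, written by resampling so that no event has to be divided out.\<close>

definition cond :: "((nat \<Rightarrow> nat) \<Rightarrow> real) \<Rightarrow> nat \<Rightarrow> nat \<Rightarrow> real" where
  "cond a j q = mean (\<lambda>x. a (x(j := q)))"

lemma finite_cube [simp]: "finite cube"
  by (auto simp: cube_def intro: finite_PiE)

lemma card_cube: "card cube = Q ^ N"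
  by (simp add: cube_def card_PiE)

lemma card_cube_pos [simp]: "card cube > 0"
  using Q_pos by (simp add: card_cube)

lemma cube_nonempty [simp]: "cube \<noteq> {}"
  using card_cube_pos by (metis card.empty less_irrefl)

lemma cube_upd: "x \<in> cube \<Longrightarrow> j < N \<Longrightarrow> q < Q \<Longrightarrow> x(j := q) \<in> cube"
  by (auto simp: cube_def PiE_iff extensional_def)

lemma cube_less: "x \<in> cube \<Longrightarrow> j < N \<Longrightarrow> x j < Q"
  by (auto simp: cube_def PiE_iff)

lemma mean_mono: "(\<And>x. x \<in> cube \<Longrightarrow> f x \<le> g x) \<Longrightarrow> mean f \<le> mean g"
  by (auto simp: mean_def intro!: divide_right_mono sum_mono)

lemma mean_cong: "(\<And>x. x \<in> cube \<Longrightarrow> f x = g x) \<Longrightarrow> mean f = mean g"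
  by (auto simp: mean_def)

lemma mean_const [simp]: "mean (\<lambda>_. c) = c"
  by (simp add: mean_def)

lemma mean_add: "mean (\<lambda>x. f x + g x) = mean f + mean g"
  by (simp add: mean_def sum.distrib add_divide_distrib)

lemma mean_diff: "mean (\<lambda>x. f x - g x) = mean f - mean g"
  by (simp add: mean_def sum_subtractf diff_divide_distrib)

lemma mean_cmult: "mean (\<lambda>x. c * f x) = c * mean f"
  by (simp add: mean_def sum_distrib_left)

lemma mean_multc: "mean (\<lambda>x. f x * c) = mean f * c"
  by (simp add: mean_def sum_distrib_right)

lemma mean_sum: "mean (\<lambda>x. \<Sum>i\<in>A. f i x) = (\<Sum>i\<in>A. mean (f i))"
  unfolding mean_def by (subst sum.swap) (simp add: sum_divide_distrib)

lemma mean_abs: "\<bar>mean f\<bar> \<le> mean (\<lambda>x. \<bar>f x\<bar>)"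
  by (simp add: mean_def abs_divide divide_right_mono sum_abs)

lemma mean_nonneg: "(\<And>x. x \<in> cube \<Longrightarrow> 0 \<le> f x) \<Longrightarrow> 0 \<le> mean f"
  by (auto simp: mean_def intro!: divide_nonneg_nonneg sum_nonneg)

lemma avg_mono: "(\<And>q. q < Q \<Longrightarrow> f q \<le> g q) \<Longrightarrow> avg f \<le> avg g"
  by (auto simp: avg_def intro!: divide_right_mono sum_mono)

lemma avg_cong: "(\<And>q. q < Q \<Longrightarrow> f q = g q) \<Longrightarrow> avg f = avg g"
  by (auto simp: avg_def)

lemma avg_const [simp]: "avg (\<lambda>_. c) = c"
  using Q_pos by (simp add: avg_def)

lemma avg_add: "avg (\<lambda>x. f x + g x) = avg f + avg g"
  by (simp add: avg_def sum.distrib add_divide_distrib)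

lemma avg_diff: "avg (\<lambda>x. f x - g x) = avg f - avg g"
  by (simp add: avg_def sum_subtractf diff_divide_distrib)

lemma avg_cmult: "avg (\<lambda>x. c * f x) = c * avg f"
  by (simp add: avg_def sum_distrib_left)

lemma avg_sum: "avg (\<lambda>x. \<Sum>i\<in>A. f i x) = (\<Sum>i\<in>A. avg (f i))"
  unfolding avg_def by (subst sum.swap) (simp add: sum_divide_distrib)

lemma avg_mean: "avg (\<lambda>q. mean (f q)) = mean (\<lambda>x. avg (\<lambda>q. f q x))"
  by (simp add: mean_def avg_def sum_divide_distrib sum.swap[of _ "{..<Q}"] mult.commute)

lemma avg_nonneg: "(\<And>q. q < Q \<Longrightarrow> 0 \<le> f q) \<Longrightarrow> 0 \<le> avg f"
  by (auto simp: avg_def intro!: divide_nonneg_nonneg sum_nonneg)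

text \<open>The map from \<open>(x, q)\<close> to \<open>(x(j := q), x j)\<close> is an involution
  on words paired with letters.\<close>

lemma mean_resample:
  assumes "j < N"
  shows "mean h = avg (\<lambda>q. mean (\<lambda>x. h (x(j := q))))"
proof -
  have "(\<Sum>z\<in>cube \<times> {..<Q}. h ((fst z)(j := snd z))) = (\<Sum>z\<in>cube \<times> {..<Q}. h (fst z))"
    by (rule sum.reindex_bij_witness[where i = "\<lambda>(x, q). (x(j := q), x j)"
          and j = "\<lambda>(x, q). (x(j := q), x j)"])
      (use assms in \<open>auto simp: cube_upd cube_less\<close>)
  then have "(\<Sum>x\<in>cube. \<Sum>q<Q. h (x(j := q))) = (\<Sum>x\<in>cube. \<Sum>q<Q. h x)"
    by (simp only: sum.cartesian_product split_def)
  then have "(\<Sum>q<Q. \<Sum>x\<in>cube. h (x(j := q))) = real Q * (\<Sum>x\<in>cube. h x)"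
    by (subst sum.swap) (simp add: sum_distrib_left)
  then show ?thesis
    using Q_pos by (simp add: avg_def mean_def flip: sum_divide_distrib)
qed

lemma cond_nonneg:
  "(\<And>x. x \<in> cube \<Longrightarrow> 0 \<le> a x) \<Longrightarrow> j < N \<Longrightarrow> q < Q \<Longrightarrow> 0 \<le> cond a j q"
  unfolding cond_def by (rule mean_nonneg) (simp add: cube_upd)

lemma avg_cond: "j < N \<Longrightarrow> avg (cond a j) = mean a"
  unfolding cond_def by (simp add: mean_resample[of j a])

lemma cond_pos:
  assumes a: "\<And>x. x \<in> cube \<Longrightarrow> 0 \<le> a x" and "x \<in> cube" "a x > 0" "j < N"
  shows "cond a j (x j) > 0"
proof -
  have "(\<Sum>z\<in>cube. a (z(j := x j))) > 0"
    by (rule sum_pos2[of _ x]) (use assms in \<open>auto simp: cube_upd cube_less\<close>)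
  moreover have "real (card cube) > 0"
    using card_cube_pos of_nat_0_less_iff by blast
  ultimately show ?thesis
    by (simp add: cond_def mean_def)
qed

text \<open>Subadditivity of entropy: the product of the one-coordinate densities of \<open>a\<close> has
  mean one, so \<open>ln z \<le> z - 1\<close> bounds the cross entropy.\<close>

lemma sum_relative_entropy_le:
  assumes a: "\<And>x. x \<in> cube \<Longrightarrow> 0 \<le> a x \<and> a x \<le> 1" and pos: "mean a > 0"
  shows "(\<Sum>j<N. avg (\<lambda>q. cond a j q * ln (cond a j q / mean a))) \<le> - mean a * ln (mean a)"
proof -
  define w where "w j q = cond a j q / mean a" for j q
  have w0: "0 \<le> w j q" if "j < N" "q < Q" for j q
    using cond_nonneg[of a j q] a pos that by (simp add: w_def)
  have sumw: "(\<Sum>q<Q. w j q) = Q" if "j < N" for j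
  proof -
    have "(\<Sum>q<Q. cond a j q) = mean a * Q"
      using avg_cond[OF that, of a] Q_pos by (simp add: avg_def field_simps)
    then show ?thesis
      using pos by (simp add: w_def flip: sum_divide_distrib)
  qed
  have prodw: "mean (\<lambda>x. \<Prod>j<N. w j (x j)) = 1"
  proof -
    have "(\<Sum>x\<in>cube. \<Prod>j<N. w j (x j)) = (\<Prod>j<N. \<Sum>q<Q. w j q)"
      unfolding cube_def by (rule prod_sum_PiE[symmetric]) auto
    also have "\<dots> = real Q ^ N"
      by (simp add: sumw)
    finally show ?thesis
      using Q_pos by (simp add: mean_def card_cube)
  qed
  have pt: "a x * ((\<Sum>j<N. ln (w j (x j))) + ln (mean a)) \<le> mean a * (\<Prod>j<N. w j (x j)) - a x"
    if x: "x \<in> cube" for x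
  \<comment> \<open>Where \<open>a x = 0\<close>, a weight may vanish and its logarithm means
    nothing, but the factor \<open>a x\<close> removes it. Elsewhere \<open>cond_pos\<close> makes
    all weights positive.\<close>
  proof (cases "a x = 0")
    case True
    then show ?thesis
      using w0 pos x by (auto intro!: mult_nonneg_nonneg prod_nonneg simp: cube_less)
  next
    case False
    with a x have ax: "a x > 0" by (simp add: order_less_le)
    have wp: "w j (x j) > 0" if "j < N" for j
      using cond_pos[of a x j] a x ax that pos by (simp add: w_def)
    let ?p = "\<Prod>j<N. w j (x j)"
    have pp: "?p > 0" by (rule prod_pos) (simp add: wp)
    have "ln ?p = (\<Sum>j<N. ln (w j (x j)))"
      using wp by (intro ln_prod) (auto simp: less_imp_neq[symmetric])
    with ln_mult_pos[OF pos pp] have "(\<Sum>j<N. ln (w j (x j))) + ln (mean a) = ln (mean a * ?p)"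
      by simp
    also have "\<dots> \<le> mean a * ?p - 1"
      using pp pos by (intro ln_le_minus_one) simp
    finally have "a x * ((\<Sum>j<N. ln (w j (x j))) + ln (mean a)) \<le> a x * (mean a * ?p - 1)"
      using ax by (simp add: mult_left_mono)
    also have "\<dots> = a x * (mean a * ?p) - a x"
      by (simp add: algebra_simps)
    also have "a x * (mean a * ?p) \<le> 1 * (mean a * ?p)"
      using a x pp pos by (intro mult_right_mono) auto
    finally show ?thesis by simp
  qed
  have "mean (\<lambda>x. a x * ((\<Sum>j<N. ln (w j (x j))) + ln (mean a)))
      \<le> mean (\<lambda>x. mean a * (\<Prod>j<N. w j (x j)) - a x)"
    by (rule mean_mono) (rule pt)
  also have "\<dots> = 0"
    by (simp add: mean_diff mean_cmult prodw)
  finally have "(\<Sum>j<N. mean (\<lambda>x. a x * ln (w j (x j)))) + mean a * ln (mean a) \<le> 0"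
    by (simp add: distrib_left mean_add sum_distrib_left mean_sum mean_multc)
  moreover have "mean (\<lambda>x. a x * ln (w j (x j))) = avg (\<lambda>q. cond a j q * ln (w j q))"
    if "j < N" for j
    by (subst mean_resample[OF that]) (simp add: mean_multc cond_def)
  ultimately show ?thesis
    by (simp add: w_def)
qed

text \<open>The pointwise form of bounding squared Hellinger distance by relative entropy: with
  \<open>u = sqrt (r / s)\<close> it is \<open>ln (1 / u) \<le> 1 / u - 1\<close>, rescaled. The
  terms \<open>- r + s\<close> cancel once \<open>r\<close> averages to \<open>s\<close>.\<close>

lemma sqrt_diff_sq_le:
  fixes r s :: real
  assumes "0 \<le> r" "0 < s"
  shows "(sqrt r - sqrt s)\<^sup>2 \<le> r * ln (r / s) - r + s"
proof (cases "r = 0")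
  case True
  with assms show ?thesis by simp
next
  case False
  with assms have r: "r > 0" by simp
  define u where "u = sqrt r / sqrt s"
  have u: "u > 0" using r assms by (simp add: u_def)
  have rs: "r / s = u\<^sup>2" using r assms by (simp add: u_def power_divide)
  have "ln (1 / u) \<le> 1 / u - 1"
    using u by (intro ln_le_minus_one) simp
  then have "- ln u \<le> 1 / u - 1"
    using u by (simp add: ln_div)
  then have "u\<^sup>2 * (1 - 1 / u) \<le> u\<^sup>2 * ln u"
    by (intro mult_left_mono) auto
  then have "u\<^sup>2 - u \<le> u\<^sup>2 * ln u"
    using u by (simp add: power2_eq_square algebra_simps)
  then have "(u - 1)\<^sup>2 \<le> u\<^sup>2 * (2 * ln u) - u\<^sup>2 + 1"
    by (simp add: power2_eq_square algebra_simps)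
  then have "s * (u - 1)\<^sup>2 \<le> s * (u\<^sup>2 * ln (u\<^sup>2) - u\<^sup>2 + 1)"
    using u assms by (intro mult_left_mono) (simp_all add: ln_realpow)
  moreover have "s * u\<^sup>2 = r" using rs assms by (simp add: field_simps)
  moreover have "s * (u - 1)\<^sup>2 = (sqrt r - sqrt s)\<^sup>2"
  proof -
    have "sqrt r - sqrt s = sqrt s * (u - 1)"
      using assms by (simp add: u_def field_simps)
    then show ?thesis using assms by (simp add: power_mult_distrib)
  qed
  moreover have "s * (u\<^sup>2 * ln (u\<^sup>2) - u\<^sup>2 + 1) = (s * u\<^sup>2) * ln (u\<^sup>2) - s * u\<^sup>2 + s"
    by (simp add: algebra_simps)
  ultimately show ?thesis
    unfolding rs by simp
qed

lemma mean_zero_imp_cond_zero: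
  assumes a: "\<And>x. x \<in> cube \<Longrightarrow> 0 \<le> a x" and "mean a = 0" "j < N" "q < Q"
  shows "cond a j q = 0"
proof -
  have "(\<Sum>x\<in>cube. a x) = 0"
    using assms(2) by (simp add: mean_def)
  then have "\<forall>x\<in>cube. a x = 0"
    using a by (subst (asm) sum_nonneg_eq_0_iff) auto
  then show ?thesis
    using assms(3,4) by (simp add: cond_def cube_upd cong: mean_cong)
qed

lemma sum_hellinger_le:
  assumes a: "\<And>x. x \<in> cube \<Longrightarrow> 0 \<le> a x \<and> a x \<le> 1"
  shows "(\<Sum>j<N. avg (\<lambda>q. (sqrt (cond a j q) - sqrt (mean a))\<^sup>2)) \<le> - mean a * ln (mean a)"
proof (cases "mean a = 0")
  case True
  then have "avg (\<lambda>q. (sqrt (cond a j q) - sqrt (mean a))\<^sup>2) = avg (\<lambda>_. 0)" if "j < N" for j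
    using mean_zero_imp_cond_zero[of a j] a that by (intro avg_cong) simp
  with True show ?thesis by simp
next
  case False
  then have pos: "mean a > 0"
    using mean_nonneg[of a] a by (simp add: order_less_le)
  have "(\<Sum>j<N. avg (\<lambda>q. (sqrt (cond a j q) - sqrt (mean a))\<^sup>2))
      \<le> (\<Sum>j<N. avg (\<lambda>q. cond a j q * ln (cond a j q / mean a) - cond a j q + mean a))"
    using a pos by (intro sum_mono avg_mono sqrt_diff_sq_le cond_nonneg) auto
  also have "\<dots> = (\<Sum>j<N. avg (\<lambda>q. cond a j q * ln (cond a j q / mean a)))"
    by (intro sum.cong) (simp_all add: avg_add avg_diff avg_cond)
  also have "\<dots> \<le> - mean a * ln (mean a)"
    using a pos by (rule sum_relative_entropy_le)
  finally show ?thesis .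
qed

end

text \<open>Gibbs' inequality against the uniform distribution, from \<open>ln z \<le> z - 1\<close>
  at \<open>z = 1 / (p t * card T)\<close>; points of mass zero contribute nothing to the
  entropy.\<close>

lemma entropy_le_ln_card:
  fixes p :: "'t \<Rightarrow> real"
  assumes "finite T" "\<And>t. t \<in> T \<Longrightarrow> 0 \<le> p t" "(\<Sum>t\<in>T. p t) = 1"
  shows "(\<Sum>t\<in>T. - p t * ln (p t)) \<le> ln (card T)"
proof -
  have "T \<noteq> {}" using assms(3) by auto
  with assms(1) have c: "real (card T) > 0" by (simp add: card_gt_0_iff)
  have "- p t * ln (p t) - p t * ln (card T) \<le> 1 / card T - p t" if "t \<in> T" for t
  proof (cases "p t = 0")
    case False
    with assms(2)[OF that] have p: "p t > 0" by simp
    have "ln (1 / (p t * card T)) \<le> 1 / (p t * card T) - 1"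
      using p c by (intro ln_le_minus_one) simp
    then have "- ln (p t) - ln (card T) \<le> 1 / (p t * card T) - 1"
      using p c by (simp add: ln_div ln_mult)
    then have "p t * (- ln (p t) - ln (card T)) \<le> p t * (1 / (p t * card T) - 1)"
      using p by (intro mult_left_mono) auto
    with p show ?thesis by (simp add: algebra_simps)
  qed simp
  then have "(\<Sum>t\<in>T. - p t * ln (p t) - p t * ln (card T)) \<le> (\<Sum>t\<in>T. 1 / card T - p t)"
    by (intro sum_mono)
  then show ?thesis
    using c assms(3) by (simp add: sum_subtractf flip: sum_distrib_right)
qed

section \<open>Pairs of words with planted coincidences\<close>

context code_space
begin

definition override :: "nat set \<Rightarrow> (nat \<Rightarrow> nat) \<Rightarrow> (nat \<Rightarrow> nat) \<Rightarrow> nat \<Rightarrow> nat" where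
  "override S u x = (\<lambda>j. if j \<in> S then u j else x j)"

lemma override_in_cube: "u \<in> cube \<Longrightarrow> x \<in> cube \<Longrightarrow> override S u x \<in> cube"
  by (auto simp: cube_def PiE_iff override_def extensional_def)

text \<open>Both words read \<open>u\<close> on \<open>S\<close> and are independent elsewhere. For
  fixed \<open>u\<close> the two arguments are independent, so means over rectangles factor.\<close>

definition planted :: "nat set \<Rightarrow> ((nat \<Rightarrow> nat) \<Rightarrow> (nat \<Rightarrow> nat) \<Rightarrow> real) \<Rightarrow> real" where
  "planted S f = mean (\<lambda>u. mean (\<lambda>x. mean (\<lambda>y. f (override S u x) (override S u y))))"

lemma planted_mono:
  assumes "\<And>u x y. u \<in> cube \<Longrightarrow> x \<in> cube \<Longrightarrow> y \<in> cube \<Longrightarrow>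
      f (override S u x) (override S u y) \<le> g (override S u x) (override S u y)"
  shows "planted S f \<le> planted S g"
  unfolding planted_def by (intro mean_mono assms)

lemma planted_sum: "planted S (\<lambda>x y. \<Sum>i\<in>A. f i x y) = (\<Sum>i\<in>A. planted S (f i))"
  by (simp add: planted_def mean_sum)

lemma planted_add: "planted S (\<lambda>x y. f x y + g x y) = planted S f + planted S g"
  by (simp add: planted_def mean_add)

lemma planted_cmult: "planted S (\<lambda>x y. c * f x y) = c * planted S f"
  by (simp add: planted_def mean_cmult)

lemma planted_const [simp]: "planted S (\<lambda>x y. c) = c"
  by (simp add: planted_def)

lemma planted_coincidence:
  assumes "j < N" "j \<notin> S"
  shows "planted S (\<lambda>x y. of_bool (x j = y j)) = 1 / Q"
proof -
  have "mean (\<lambda>y. of_bool (c = y j)) = 1 / Q" if "c < Q" for c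
  proof -
    have "mean (\<lambda>y. of_bool (c = y j)) = avg (\<lambda>q. of_bool (c = q))"
      by (subst mean_resample[OF assms(1)]) simp
    also have "\<dots> = 1 / Q"
      using that by (simp add: avg_def of_bool_def sum.delta)
    finally show ?thesis .
  qed
  then have "mean (\<lambda>x. mean (\<lambda>y. of_bool (x j = y j))) = mean (\<lambda>_. 1 / Q)"
    using assms by (intro mean_cong) (simp add: cube_less)
  with assms show ?thesis
    by (simp add: planted_def override_def)
qed

end

section \<open>Transcript distributions of rectangle partitions\<close>

text \<open>A partition of \<open>X \<times> Y\<close> into combinatorial rectangles, indexed by transcripts.\<close>

locale rectangle_partition = code_space +
  fixes T :: "'t set" and a b :: "'t \<Rightarrow> (nat \<Rightarrow> nat) \<Rightarrow> real"
  assumes finite_T: "finite T"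
    and a_bounds: "\<And>t x. 0 \<le> a t x \<and> a t x \<le> 1"
    and b_bounds: "\<And>t y. 0 \<le> b t y \<and> b t y \<le> 1"
    and partition: "\<And>x y. x \<in> cube \<Longrightarrow> y \<in> cube \<Longrightarrow> (\<Sum>t\<in>T. a t x * b t y) = 1"
begin

lemma mean_a: "0 \<le> mean (a t)" and mean_b: "0 \<le> mean (b t)"
  using a_bounds b_bounds by (auto intro!: mean_nonneg)

lemma cond_a: "0 \<le> cond (a t) j q" and cond_b: "0 \<le> cond (b t) j q"
  unfolding cond_def using a_bounds b_bounds by (auto intro!: mean_nonneg)

text \<open>Independence lets the means factor. Hence each of the four combinations of original and
  resampled words yields transcript probabilities of total mass 1, as cut and paste
  requires.\<close>

lemma sum_mean_mean_eq_1:
  assumes "\<And>x. x \<in> cube \<Longrightarrow> f x \<in> cube" "\<And>y. y \<in> cube \<Longrightarrow> g y \<in> cube"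
  shows "(\<Sum>t\<in>T. mean (\<lambda>x. a t (f x)) * mean (\<lambda>y. b t (g y))) = 1"
proof -
  have "(\<Sum>t\<in>T. mean (\<lambda>x. a t (f x)) * mean (\<lambda>y. b t (g y)))
      = mean (\<lambda>x. mean (\<lambda>y. \<Sum>t\<in>T. a t (f x) * b t (g y)))"
    by (simp add: mean_sum mean_cmult mean_multc)
  also have "\<dots> = mean (\<lambda>x. mean (\<lambda>y. 1))"
    by (intro mean_cong) (simp add: partition assms)
  finally show ?thesis by simp
qed

text \<open>Cut and paste: the Hellinger distance between the transcript distributions
  \<open>\<alpha>\<^sub>q \<beta>\<^sub>q\<close> and \<open>\<alpha> \<beta>\<close> equals the one between \<open>\<alpha>\<^sub>q \<beta>\<close> and \<open>\<alpha> \<beta>\<^sub>q\<close>, which the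
  triangle inequality bounds by the influence of each player separately.\<close>

lemma hellinger_cut_paste:
  assumes "j < N" "q < Q"
  shows "(\<Sum>t\<in>T. (sqrt (cond (a t) j q * cond (b t) j q) - sqrt (mean (a t) * mean (b t)))\<^sup>2)
    \<le> 2 * (\<Sum>t\<in>T. mean (b t) * (sqrt (cond (a t) j q) - sqrt (mean (a t)))\<^sup>2)
      + 2 * (\<Sum>t\<in>T. mean (a t) * (sqrt (cond (b t) j q) - sqrt (mean (b t)))\<^sup>2)"
proof -
  define A B A' B' where "A t = mean (a t)" and "B t = mean (b t)"
    and "A' t = cond (a t) j q" and "B' t = cond (b t) j q" for t
  note defs = A_def B_def A'_def B'_def
  have nn: "0 \<le> A t" "0 \<le> B t" "0 \<le> A' t" "0 \<le> B' t" for t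
    by (simp_all add: defs mean_a mean_b cond_a cond_b)
  have up: "x(j := q) \<in> cube" if "x \<in> cube" for x
    using assms that by (simp add: cube_upd)
  have s: "(\<Sum>t\<in>T. A t * B t) = 1" "(\<Sum>t\<in>T. A' t * B t) = 1"
    "(\<Sum>t\<in>T. A t * B' t) = 1" "(\<Sum>t\<in>T. A' t * B' t) = 1"
    unfolding defs cond_def
    using sum_mean_mean_eq_1[of "\<lambda>x. x" "\<lambda>y. y"] sum_mean_mean_eq_1[of "\<lambda>x. x(j := q)" "\<lambda>y. y"]
      sum_mean_mean_eq_1[of "\<lambda>x. x" "\<lambda>y. y(j := q)"]
      sum_mean_mean_eq_1[of "\<lambda>x. x(j := q)" "\<lambda>y. y(j := q)"] up by auto
  have sq: "(sqrt r - sqrt s)\<^sup>2 = r + s - 2 * sqrt (r * s)" if "0 \<le> r" "0 \<le> s" for r s :: real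
    using that by (simp add: power2_diff real_sqrt_mult)
  have "(\<Sum>t\<in>T. (sqrt (A' t * B' t) - sqrt (A t * B t))\<^sup>2)
      = (\<Sum>t\<in>T. A' t * B' t + A t * B t - 2 * sqrt ((A' t * B' t) * (A t * B t)))"
    using nn by (simp add: sq)
  \<comment> \<open>The cut-and-paste identity: all four products have total mass 1, and both square
    roots contain the same four factors, so the two sides are the same number.\<close>
  also have "\<dots> = (\<Sum>t\<in>T. A' t * B t + A t * B' t - 2 * sqrt ((A' t * B t) * (A t * B' t)))"
    by (simp add: sum_subtractf sum.distrib s mult.commute mult.left_commute)
  also have "\<dots> = (\<Sum>t\<in>T. (sqrt (A' t * B t) - sqrt (A t * B' t))\<^sup>2)"
    using nn by (simp add: sq)
  also have "\<dots> \<le> (\<Sum>t\<in>T. 2 * (B t * (sqrt (A' t) - sqrt (A t))\<^sup>2)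
      + 2 * (A t * (sqrt (B' t) - sqrt (B t))\<^sup>2))"
  proof (rule sum_mono)
    fix t
    let ?u = "sqrt (B t) * (sqrt (A' t) - sqrt (A t))"
    let ?v = "sqrt (A t) * (sqrt (B' t) - sqrt (B t))"
    have "sqrt (A' t * B t) - sqrt (A t * B' t) = ?u - ?v"
      by (simp add: real_sqrt_mult algebra_simps)
    moreover have "(?u - ?v)\<^sup>2 \<le> 2 * ?u\<^sup>2 + 2 * ?v\<^sup>2"
      using zero_le_power2[of "?u + ?v"] by (simp add: power2_sum power2_diff)
    ultimately show "(sqrt (A' t * B t) - sqrt (A t * B' t))\<^sup>2
        \<le> 2 * (B t * (sqrt (A' t) - sqrt (A t))\<^sup>2) + 2 * (A t * (sqrt (B' t) - sqrt (B t))\<^sup>2)"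
      using nn by (simp add: power_mult_distrib)
  qed
  finally show ?thesis
    by (simp add: defs sum.distrib sum_distrib_left)
qed

text \<open>\<open>sum_hellinger_le\<close> bounds each player's influence by
  \<open>- z ln z\<close> for that player's factor \<open>z\<close>. Weighted by the other player's
  factor, the two bounds add up to the entropy of the probabilities
  \<open>mean (a t) * mean (b t)\<close>.\<close>

lemma sum_hellinger_transcripts_le:
  "(\<Sum>j<N. avg (\<lambda>q. \<Sum>t\<in>T.
      (sqrt (cond (a t) j q * cond (b t) j q) - sqrt (mean (a t) * mean (b t)))\<^sup>2))
    \<le> 2 * ln (card T)"
proof -
  let ?hA = "\<lambda>j t. avg (\<lambda>q. (sqrt (cond (a t) j q) - sqrt (mean (a t)))\<^sup>2)"
  let ?hB = "\<lambda>j t. avg (\<lambda>q. (sqrt (cond (b t) j q) - sqrt (mean (b t)))\<^sup>2)"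
  have "(\<Sum>j<N. avg (\<lambda>q. \<Sum>t\<in>T.
      (sqrt (cond (a t) j q * cond (b t) j q) - sqrt (mean (a t) * mean (b t)))\<^sup>2))
    \<le> (\<Sum>j<N. avg (\<lambda>q.
        2 * (\<Sum>t\<in>T. mean (b t) * (sqrt (cond (a t) j q) - sqrt (mean (a t)))\<^sup>2)
      + 2 * (\<Sum>t\<in>T. mean (a t) * (sqrt (cond (b t) j q) - sqrt (mean (b t)))\<^sup>2)))"
    by (intro sum_mono avg_mono hellinger_cut_paste) auto
  also have "\<dots> = (\<Sum>j<N. 2 * (\<Sum>t\<in>T. mean (b t) * ?hA j t) + 2 * (\<Sum>t\<in>T. mean (a t) * ?hB j t))"
    by (simp add: avg_add avg_cmult avg_sum)
  also have "\<dots> = 2 * (\<Sum>j<N. \<Sum>t\<in>T. mean (b t) * ?hA j t) + 2 * (\<Sum>j<N. \<Sum>t\<in>T. mean (a t) * ?hB j t)"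
    by (simp only: sum.distrib sum_distrib_left)
  also have "\<dots> = 2 * (\<Sum>t\<in>T. mean (b t) * (\<Sum>j<N. ?hA j t)) + 2 * (\<Sum>t\<in>T. mean (a t) * (\<Sum>j<N. ?hB j t))"
    by (simp only: sum.swap[of _ T] sum_distrib_left)
  also have "\<dots> \<le> 2 * (\<Sum>t\<in>T. mean (b t) * (- mean (a t) * ln (mean (a t))))
      + 2 * (\<Sum>t\<in>T. mean (a t) * (- mean (b t) * ln (mean (b t))))"
    by (intro add_mono mult_left_mono sum_mono sum_hellinger_le mean_a mean_b a_bounds b_bounds) auto
  also have "\<dots> = 2 * (\<Sum>t\<in>T. - (mean (a t) * mean (b t)) * ln (mean (a t) * mean (b t)))"
  proof -
    have "mean (b t) * (- mean (a t) * ln (mean (a t))) + mean (a t) * (- mean (b t) * ln (mean (b t)))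
        = - (mean (a t) * mean (b t)) * ln (mean (a t) * mean (b t))" for t
    proof (cases "mean (a t) = 0 \<or> mean (b t) = 0")
      case False
      with mean_a[of t] mean_b[of t] show ?thesis
        by (simp add: ln_mult algebra_simps)
    qed auto
    then show ?thesis
      by (simp only: sum.distrib[symmetric] distrib_left[symmetric])
  qed
  also have "\<dots> \<le> 2 * ln (card T)"
    using sum_mean_mean_eq_1[of "\<lambda>x. x" "\<lambda>y. y"]
    by (intro mult_left_mono entropy_le_ln_card finite_T) (auto simp: mean_a mean_b)
  finally show ?thesis .
qed

text \<open>The difference of \<open>f\<close> and \<open>g\<close> is the product of the difference
  and the sum of their roots. Splitting it by a weighted arithmetic-geometric mean inequality,
  rather than by Cauchy-Schwarz, keeps the bound linear in the squared Hellinger distance, so that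
  it can be summed over \<open>j\<close>; \<delta> is left free for the final balance.\<close>

lemma sum_variation_le:
  fixes \<delta> :: real
  assumes "\<delta> > 0"
  shows "(\<Sum>j<N. avg (\<lambda>q. \<Sum>t\<in>T. \<bar>cond (a t) j q * cond (b t) j q - mean (a t) * mean (b t)\<bar>))
    \<le> \<delta> * N + 2 * ln (card T) / \<delta>"
proof -
  let ?H = "\<lambda>j q. \<Sum>t\<in>T. (sqrt (cond (a t) j q * cond (b t) j q) - sqrt (mean (a t) * mean (b t)))\<^sup>2"
  have tv: "(\<Sum>t\<in>T. \<bar>cond (a t) j q * cond (b t) j q - mean (a t) * mean (b t)\<bar>) \<le> \<delta> + 1 / \<delta> * ?H j q"
    if jq: "j < N" "q < Q" for j q
  proof -
    define f g where "f t = cond (a t) j q * cond (b t) j q" and "g t = mean (a t) * mean (b t)" for t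
    have nn: "0 \<le> f t" "0 \<le> g t" for t
      by (simp_all add: f_def g_def mean_a mean_b cond_a cond_b)
    have s: "(\<Sum>t\<in>T. f t) = 1" "(\<Sum>t\<in>T. g t) = 1"
      unfolding f_def g_def cond_def
      using sum_mean_mean_eq_1[of "\<lambda>x. x" "\<lambda>y. y"]
        sum_mean_mean_eq_1[of "\<lambda>x. x(j := q)" "\<lambda>y. y(j := q)"] jq by (auto simp: cube_upd)
    have "\<bar>f t - g t\<bar> \<le> 1 / \<delta> * (sqrt (f t) - sqrt (g t))\<^sup>2 + \<delta> / 2 * (f t + g t)" for t
    proof -
      let ?m = "\<bar>sqrt (f t) - sqrt (g t)\<bar>" and ?p = "sqrt (f t) + sqrt (g t)"
      have "f t - g t = (sqrt (f t) - sqrt (g t)) * ?p"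
        using nn[of t] by (simp add: algebra_simps)
      then have "\<bar>f t - g t\<bar> = ?m * ?p"
        using nn[of t] by (simp add: abs_mult)
      also have "\<dots> \<le> 1 / \<delta> * ?m\<^sup>2 + \<delta> / 4 * ?p\<^sup>2"
      proof -
        have "0 \<le> 1 / \<delta> * (?m - \<delta> / 2 * ?p)\<^sup>2"
          using assms by simp
        also have "\<dots> = 1 / \<delta> * ?m\<^sup>2 + \<delta> / 4 * ?p\<^sup>2 - ?m * ?p"
          using assms by (simp add: power2_eq_square field_simps)
        finally show ?thesis by simp
      qed
      also have "?p\<^sup>2 \<le> 2 * (f t + g t)"
        using nn[of t] zero_le_power2[of "sqrt (f t) - sqrt (g t)"] by (simp add: power2_sum power2_diff)
      finally show ?thesis
        using assms by (simp add: mult_left_mono field_simps)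
    qed
    then have "(\<Sum>t\<in>T. \<bar>f t - g t\<bar>) \<le> (\<Sum>t\<in>T. 1 / \<delta> * (sqrt (f t) - sqrt (g t))\<^sup>2 + \<delta> / 2 * (f t + g t))"
      by (rule sum_mono)
    also have "\<dots> = 1 / \<delta> * (\<Sum>t\<in>T. (sqrt (f t) - sqrt (g t))\<^sup>2) + \<delta> / 2 * (1 + 1)"
      by (simp only: sum.distrib sum_distrib_left[symmetric] s)
    finally show ?thesis
      by (simp add: f_def g_def)
  qed
  have "(\<Sum>j<N. avg (\<lambda>q. \<Sum>t\<in>T. \<bar>cond (a t) j q * cond (b t) j q - mean (a t) * mean (b t)\<bar>))
      \<le> (\<Sum>j<N. avg (\<lambda>q. \<delta> + 1 / \<delta> * ?H j q))"
    by (intro sum_mono avg_mono tv) auto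
  also have "\<dots> = \<delta> * N + 1 / \<delta> * (\<Sum>j<N. avg (?H j))"
    by (simp only: avg_add avg_cmult avg_const sum.distrib sum_distrib_left[symmetric]
        sum_constant card_lessThan) (simp add: mult.commute)
  also have "\<dots> \<le> \<delta> * N + 1 / \<delta> * (2 * ln (card T))"
    using assms by (intro add_left_mono mult_left_mono sum_hellinger_transcripts_le) auto
  finally show ?thesis by simp
qed

text \<open>The L1 distance between the transcript distributions with and without \<open>j\<close>
  planted on top of \<open>S\<close>, taken for fixed \<open>u\<close> and then averaged over
  \<open>u\<close>.\<close>

definition shift :: "nat set \<Rightarrow> nat \<Rightarrow> real" where
  "shift S j = mean (\<lambda>u. \<Sum>t\<in>T.
     \<bar>mean (\<lambda>x. a t (override (insert j S) u x)) * mean (\<lambda>y. b t (override (insert j S) u y))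
      - mean (\<lambda>x. a t (override S u x)) * mean (\<lambda>y. b t (override S u y))\<bar>)"

text \<open>A test of the transcript with values bounded by 1 separates two distributions by at most
  their L1 distance.\<close>

lemma planted_insert_diff_le:
  assumes g: "\<And>t. \<bar>g t\<bar> \<le> 1"
  shows "\<bar>planted (insert j S) (\<lambda>x y. \<Sum>t\<in>T. g t * (a t x * b t y))
    - planted S (\<lambda>x y. \<Sum>t\<in>T. g t * (a t x * b t y))\<bar> \<le> shift S j"
proof -
  define P where "P S u t = mean (\<lambda>x. a t (override S u x)) * mean (\<lambda>y. b t (override S u y))" for S u t
  have pl: "planted S (\<lambda>x y. \<Sum>t\<in>T. g t * (a t x * b t y)) = mean (\<lambda>u. \<Sum>t\<in>T. g t * P S u t)" for S
    by (simp add: planted_def P_def mean_sum mean_cmult mean_multc)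
  have "\<bar>mean (\<lambda>u. (\<Sum>t\<in>T. g t * P (insert j S) u t) - (\<Sum>t\<in>T. g t * P S u t))\<bar>
      \<le> mean (\<lambda>u. \<bar>(\<Sum>t\<in>T. g t * P (insert j S) u t) - (\<Sum>t\<in>T. g t * P S u t)\<bar>)"
    by (rule mean_abs)
  also have "\<dots> \<le> mean (\<lambda>u. \<Sum>t\<in>T. \<bar>P (insert j S) u t - P S u t\<bar>)"
  proof (rule mean_mono)
    fix u
    have "\<bar>\<Sum>t\<in>T. g t * (P (insert j S) u t - P S u t)\<bar> \<le> (\<Sum>t\<in>T. \<bar>g t * (P (insert j S) u t - P S u t)\<bar>)"
      by (rule sum_abs)
    also have "\<dots> \<le> (\<Sum>t\<in>T. \<bar>P (insert j S) u t - P S u t\<bar>)"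
      using g by (intro sum_mono) (simp add: abs_mult mult_left_le_one_le)
    finally show "\<bar>(\<Sum>t\<in>T. g t * P (insert j S) u t) - (\<Sum>t\<in>T. g t * P S u t)\<bar>
        \<le> (\<Sum>t\<in>T. \<bar>P (insert j S) u t - P S u t\<bar>)"
      by (simp add: right_diff_distrib sum_subtractf)
  qed
  finally show ?thesis
    by (simp add: pl mean_diff shift_def P_def)
qed

text \<open>Fixing \<open>u\<close> on \<open>S\<close> leaves a rectangle partition in the
  remaining coordinates, so \<open>sum_variation_le\<close> applies with the same bound however many
  hits are already planted.\<close>

lemma sum_shift_le:
  fixes \<delta> :: real
  assumes "\<delta> > 0"
  shows "(\<Sum>j<N. shift S j) \<le> \<delta> * N + 2 * ln (card T) / \<delta>"
proof -
  define V where "V u j q = (\<Sum>t\<in>T.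
      \<bar>cond (\<lambda>x. a t (override S u x)) j q * cond (\<lambda>y. b t (override S u y)) j q
       - mean (\<lambda>x. a t (override S u x)) * mean (\<lambda>y. b t (override S u y))\<bar>)" for u j q
  have V: "(\<Sum>j<N. avg (V u j)) \<le> \<delta> * N + 2 * ln (card T) / \<delta>" if u: "u \<in> cube" for u
  proof -
    interpret R: rectangle_partition N Q T "\<lambda>t x. a t (override S u x)" "\<lambda>t y. b t (override S u y)"
      by unfold_locales (use finite_T a_bounds b_bounds partition u in \<open>auto simp: override_in_cube\<close>)
    show ?thesis
      unfolding V_def using R.sum_variation_le[OF assms] .
  qed
  have "shift S j \<le> mean (\<lambda>u. avg (V u j))" if j: "j < N" for j
  proof (cases "j \<in> S")
    case True
    then have "shift S j = 0" by (simp add: shift_def insert_absorb)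
    moreover have "0 \<le> mean (\<lambda>u. avg (V u j))"
      by (intro mean_nonneg avg_nonneg) (simp add: V_def sum_nonneg)
    ultimately show ?thesis by simp
  next
    case False
    have o1: "override (insert j S) (u(j := q)) x = override S u (x(j := q))"
      and o2: "override S (u(j := q)) x = override S u x" for u q x
      using False by (auto simp: override_def fun_eq_iff)
    \<comment> \<open>For \<open>j\<close> outside \<open>S\<close>, the letter \<open>u j\<close>
      is read only under \<open>insert j S\<close>; resampling it turns the planted letter into the
      \<open>q\<close> of \<open>cond\<close>.\<close>
    have "shift S j = avg (\<lambda>q. mean (\<lambda>u. V u j q))"
      unfolding shift_def by (subst mean_resample[OF j]) (simp add: o1 o2 V_def cond_def)
    then show ?thesis by (simp add: avg_mean)
  qed
  then have "(\<Sum>j<N. shift S j) \<le> (\<Sum>j<N. mean (\<lambda>u. avg (V u j)))"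
    by (intro sum_mono) simp
  also have "\<dots> = mean (\<lambda>u. \<Sum>j<N. avg (V u j))"
    by (simp add: mean_sum)
  also have "\<dots> \<le> mean (\<lambda>_. \<delta> * N + 2 * ln (card T) / \<delta>)"
    by (intro mean_mono V)
  finally show ?thesis by simp
qed

end

section \<open>Gram determinants\<close>

definition inner_sum :: "nat \<Rightarrow> (nat \<Rightarrow> real) \<Rightarrow> (nat \<Rightarrow> real) \<Rightarrow> real" where
  "inner_sum d f g = (\<Sum>c<d. f c * g c)"

lemma inner_sum_commute: "inner_sum d f g = inner_sum d g f"
  by (simp add: inner_sum_def mult.commute)

lemma inner_sum_nonneg: "0 \<le> inner_sum d f f"
  by (simp add: inner_sum_def sum_nonneg)

lemma inner_sum_diff: "inner_sum d (\<lambda>c. f c - g c) h = inner_sum d f h - inner_sum d g h"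
  by (simp add: inner_sum_def left_diff_distrib sum_subtractf)

lemma inner_sum_scale: "inner_sum d (\<lambda>c. r * f c) h = r * inner_sum d f h"
  by (simp add: inner_sum_def sum_distrib_left mult.assoc)

lemma inner_sum_sum: "inner_sum d (\<lambda>c. \<Sum>i\<in>A. f i c) h = (\<Sum>i\<in>A. inner_sum d (f i) h)"
  unfolding inner_sum_def by (subst sum.swap) (simp add: sum_distrib_right)

lemma inner_sum_eq_0_left: "inner_sum d f f = 0 \<Longrightarrow> inner_sum d f g = 0"
  by (auto simp: inner_sum_def sum_nonneg_eq_0_iff)

text \<open>Gram-Schmidt without normalisation. Dependent vectors are allowed: where
  \<open>gso d v j\<close> has norm 0, division by zero gives coefficient 0.\<close>

function gso :: "nat \<Rightarrow> (nat \<Rightarrow> nat \<Rightarrow> real) \<Rightarrow> nat \<Rightarrow> nat \<Rightarrow> real" where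
  "gso d v i = (\<lambda>c. v i c - (\<Sum>j\<in>{j. j < i}. 
     inner_sum d (v i) (gso d v j) / inner_sum d (gso d v j) (gso d v j) * gso d v j c))"
  by pat_completeness auto
termination
  by (relation "Wellfounded.measure (\<lambda>(d, v, i). i)") auto

declare gso.simps [simp del]

context
  fixes d :: nat and v :: "nat \<Rightarrow> nat \<Rightarrow> real"
begin

private abbreviation (input) "g \<equiv> gso d v"
private abbreviation (input) "ip \<equiv> inner_sum d"

definition gso_coeff :: "nat \<Rightarrow> nat \<Rightarrow> real" where
  "gso_coeff i l =
     (if l = i then 1 else if l < i then ip (v i) (g l) / ip (g l) (g l) else 0)"

lemma gso_orthogonal_less: "j < i \<Longrightarrow> ip (g i) (g j) = 0"
proof (induction i arbitrary: j rule: less_induct)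
  case (less i)
  have orth: "ip (g l) (g j) = 0" if "l < i" "l \<noteq> j" for l
    using less.IH[of l j] less.IH[of j l] less.prems that
    by (cases "l < j") (simp_all add: inner_sum_commute[of d "g l" "g j"])
  have "ip (g i) (g j) = ip (v i) (g j) - (\<Sum>l<i. ip (v i) (g l) / ip (g l) (g l) * ip (g l) (g j))"
    by (subst gso.simps) (simp only: inner_sum_diff inner_sum_sum inner_sum_scale flip: lessThan_def)
  also have "(\<Sum>l<i. ip (v i) (g l) / ip (g l) (g l) * ip (g l) (g j))
      = (\<Sum>l<i. if l = j then ip (v i) (g l) / ip (g l) (g l) * ip (g l) (g j) else 0)"
    by (intro sum.cong) (auto simp: orth)
  also have "\<dots> = ip (v i) (g j) / ip (g j) (g j) * ip (g j) (g j)"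
    using less.prems by simp
  \<comment> \<open>If \<open>g j\<close> has norm 0, the quotient is 0, but then so is
    \<open>ip (v i) (g j)\<close>.\<close>
  also have "\<dots> = ip (v i) (g j)"
    using inner_sum_eq_0_left[of d "g j" "v i"] by (auto simp: inner_sum_commute[of d "v i"])
  finally show ?case by simp
qed

lemma gso_orthogonal: "i \<noteq> j \<Longrightarrow> ip (g i) (g j) = 0"
  using gso_orthogonal_less[of i j] gso_orthogonal_less[of j i]
  by (cases "i < j") (simp_all add: inner_sum_commute[of d "g i" "g j"])

lemma gso_decomposition:
  assumes "i < m"
  shows "v i = (\<lambda>c. \<Sum>l<m. gso_coeff i l * g l c)"
proof
  fix c
  have "(\<Sum>l<m. gso_coeff i l * g l c) = (\<Sum>l\<in>insert i {..<i}. gso_coeff i l * g l c)"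
    using assms by (intro sum.mono_neutral_right) (auto simp: gso_coeff_def)
  also have "\<dots> = g i c + (\<Sum>l<i. ip (v i) (g l) / ip (g l) (g l) * g l c)"
    by (simp add: gso_coeff_def)
  also have "\<dots> = v i c"
    by (subst gso.simps) (simp flip: lessThan_def)
  finally show "v i c = (\<Sum>l<m. gso_coeff i l * g l c)" by simp
qed

lemma inner_gso:
  assumes "i < m" "l < m"
  shows "ip (v i) (g l) = gso_coeff i l * ip (g l) (g l)"
proof -
  have "ip (v i) (g l) = (\<Sum>l'<m. gso_coeff i l' * ip (g l') (g l))"
    by (subst gso_decomposition[OF assms(1)]) (simp add: inner_sum_sum inner_sum_scale)
  also have "\<dots> = (\<Sum>l'<m. if l' = l then gso_coeff i l' * ip (g l') (g l) else 0)"
    by (intro sum.cong) (auto simp: gso_orthogonal)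
  finally show ?thesis using assms by simp
qed

text \<open>The Gram matrix is \<open>L * U\<close>: \<open>L\<close> is unit lower triangular and
  holds the Gram-Schmidt coefficients, and \<open>U\<close> is the transpose of \<open>L\<close>
  with its rows scaled by the squared norms of the \<open>g l\<close>.\<close>

lemma gram_det_eq_prod_gso:
  "Determinant.det (Matrix.mat m m (\<lambda>(i, j). ip (v i) (v j))) = (\<Prod>i<m. ip (g i) (g i))"
proof -
  define L where "L = Matrix.mat m m (\<lambda>(i, l). gso_coeff i l)"
  define U where "U = Matrix.mat m m (\<lambda>(l, j). ip (g l) (g l) * gso_coeff j l)"
  have LU: "L \<in> carrier_mat m m" "U \<in> carrier_mat m m"
    by (auto simp: L_def U_def)
  have "Matrix.mat m m (\<lambda>(i, j). ip (v i) (v j)) = L * U"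
  proof (rule eq_matI)
    fix i j assume "i < dim_row (L * U)" "j < dim_col (L * U)"
    then have ij: "i < m" "j < m" by (auto simp: L_def U_def)
    have "ip (v i) (v j) = (\<Sum>l<m. gso_coeff i l * ip (v j) (g l))"
      by (subst gso_decomposition[OF ij(1)])
        (simp add: inner_sum_sum inner_sum_scale inner_sum_commute[of d "v j"])
    also have "\<dots> = (\<Sum>l<m. gso_coeff i l * (ip (g l) (g l) * gso_coeff j l))"
      by (intro sum.cong) (simp_all add: inner_gso[OF ij(2)])
    finally show "Matrix.mat m m (\<lambda>(i, j). ip (v i) (v j)) $$ (i, j) = (L * U) $$ (i, j)"
      using ij by (simp add: L_def U_def scalar_prod_def atLeast0LessThan)
  qed (auto simp: L_def U_def)
  moreover have "Determinant.det L = 1"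
  proof -
    have "Determinant.det L = prod_list (diag_mat L)"
      by (rule det_lower_triangular[OF _ LU(1)]) (simp add: L_def gso_coeff_def)
    also have "diag_mat L = map (\<lambda>_. 1) [0..<m]"
      by (simp add: diag_mat_def L_def gso_coeff_def)
    finally show ?thesis by (simp add: prod_list_replicate map_replicate_const)
  qed
  moreover have "Determinant.det U = (\<Prod>i<m. ip (g i) (g i))"
  proof -
    have "Determinant.det U = prod_list (diag_mat U)"
      by (rule det_upper_triangular[OF _ LU(2)]) (auto simp: U_def gso_coeff_def)
    also have "diag_mat U = map (\<lambda>i. ip (g i) (g i)) [0..<m]"
      by (simp add: diag_mat_def U_def gso_coeff_def)
    finally show ?thesis
      by (simp add: prod.distinct_set_conv_list[symmetric] atLeast0LessThan)
  qed
  ultimately show ?thesis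
    by (simp add: det_mult[OF LU])
qed

text \<open>A Gram determinant is a product of squared distances to the span of the preceding
  vectors, and each of these is at most the distance to a multiple of one preceding vector.\<close>

lemma gram_det_le_prod:
  assumes "\<And>i. i < m \<Longrightarrow> \<exists>j r. (r = 0 \<or> j < i) \<and>
    ip (v i) (v i) - 2 * r * ip (v i) (v j) + r\<^sup>2 * ip (v j) (v j) \<le> t i"
  shows "Determinant.det (Matrix.mat m m (\<lambda>(i, j). ip (v i) (v j))) \<le> (\<Prod>i<m. t i)"
  unfolding gram_det_eq_prod_gso
proof (intro prod_mono conjI)
  fix i assume "i \<in> {..<m}"
  then have i: "i < m" by simp
  obtain j r where jr: "r = 0 \<or> j < i"
    and le: "ip (v i) (v i) - 2 * r * ip (v i) (v j) + r\<^sup>2 * ip (v j) (v j) \<le> t i"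
    using assms[OF i] by blast
  have gv: "ip (g i) (v i) = ip (g i) (g i)"
    using inner_gso[OF i i] by (simp add: gso_coeff_def inner_sum_commute[of d "g i" "v i"])
  have gw: "r * ip (g i) (v j) = 0"
    using jr inner_gso[of j m i] i by (auto simp: gso_coeff_def inner_sum_commute[of d "g i" "v j"])
  \<comment> \<open>Pythagoras: \<open>g i\<close> is orthogonal to \<open>r\<close> times
    \<open>v j\<close>, and its product with \<open>v i\<close> is its own squared norm. So the
    squared norm of \<open>e\<close> is the squared distance in question minus that of
    \<open>g i\<close>.\<close>
  define e where "e = (\<lambda>c. v i c - r * v j c - g i c)"
  have exp: "ip e h = ip (v i) h - r * ip (v j) h - ip (g i) h" for h
    by (simp add: e_def inner_sum_diff inner_sum_scale)
  have "0 \<le> ip e e"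
    by (rule inner_sum_nonneg)
  also have "ip e e = ip e (v i) - r * ip e (v j) - ip e (g i)"
    by (subst exp[of e]) (simp only: inner_sum_commute[of d e "v i"]
        inner_sum_commute[of d e "v j"] inner_sum_commute[of d e "g i"])
  also have "\<dots> = ip (v i) (v i) - 2 * r * ip (v i) (v j) + r\<^sup>2 * ip (v j) (v j)
      - 2 * ip (g i) (v i) + 2 * (r * ip (g i) (v j)) + ip (g i) (g i)"
  proof -
    have c: "ip (v j) (v i) = ip (v i) (v j)" "ip (v i) (g i) = ip (g i) (v i)"
      "ip (v j) (g i) = ip (g i) (v j)"
      by (rule inner_sum_commute)+
    show ?thesis
      unfolding exp c by (simp add: power2_eq_square algebra_simps)
  qed
  finally show "ip (g i) (g i) \<le> t i"
    using le gv gw by simp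
qed (simp add: inner_sum_nonneg)

end

section \<open>Volumes as Gram determinants\<close>

lemma inner_sum_of_int_vec:
  assumes "v \<in> carrier_vec d" "w \<in> carrier_vec d"
  shows "inner_sum d (\<lambda>c. of_int (vec_index v c)) (\<lambda>c. of_int (vec_index w c)) = of_int (v \<bullet> w)"
  using assms by (simp add: inner_sum_def scalar_prod_def atLeast0LessThan)

lemma chosen_rows_gram:
  assumes "A \<in> carrier_mat n d" "set js \<subseteq> {..<n}"
  shows "chosen_rows A js * transpose_mat (chosen_rows A js)
    = Matrix.mat (length js) (length js) (\<lambda>(i, j). Matrix.row A (js ! i) \<bullet> Matrix.row A (js ! j))"
proof (rule eq_matI)
  fix i j
  assume "i < dim_row (Matrix.mat (length js) (length js)
      (\<lambda>(i, j). Matrix.row A (js ! i) \<bullet> Matrix.row A (js ! j)))"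
    and "j < dim_col (Matrix.mat (length js) (length js)
      (\<lambda>(i, j). Matrix.row A (js ! i) \<bullet> Matrix.row A (js ! j)))"
  then have ij: "i < length js" "j < length js" by auto
  have r: "Matrix.row (chosen_rows A js) l = Matrix.row A (js ! l)" if "l < length js" for l
    using assms that unfolding chosen_rows_def by (subst mat_of_rows_row) auto
  show "(chosen_rows A js * transpose_mat (chosen_rows A js)) $$ (i, j)
    = Matrix.mat (length js) (length js)
        (\<lambda>(i, j). Matrix.row A (js ! i) \<bullet> Matrix.row A (js ! j)) $$ (i, j)"
    using ij by (simp add: r) (simp add: chosen_rows_def r[unfolded chosen_rows_def])
qed (simp_all add: chosen_rows_def)

lemma finite_row_choices: "finite (row_choices n m)"
  by (rule finite_subset[OF _ finite_lists_length_eq[of "{..<n}" m]]) (auto simp: row_choices_def)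

lemma volume_le_max_volume:
  "js \<in> row_choices (dim_row A) m \<Longrightarrow> volume A js \<le> max_volume A m"
  unfolding max_volume_def by (intro Max_ge finite_imageI finite_row_choices) auto

lemma volume_le_sqrt_prod:
  assumes A: "A \<in> carrier_mat n d" and js: "set js \<subseteq> {..<n}"
    and t: "\<And>i. i < length js \<Longrightarrow> \<exists>j r. (r = 0 \<or> j < i) \<and>
      of_int (Matrix.row A (js ! i) \<bullet> Matrix.row A (js ! i))
      - 2 * r * of_int (Matrix.row A (js ! i) \<bullet> Matrix.row A (js ! j))
      + r\<^sup>2 * of_int (Matrix.row A (js ! j) \<bullet> Matrix.row A (js ! j)) \<le> t i"
  shows "volume A js \<le> sqrt (\<Prod>i<length js. t i)"
proof -
  define v :: "nat \<Rightarrow> nat \<Rightarrow> real" where "v i c = of_int (vec_index (Matrix.row A (js ! i)) c)" for i c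
  have ip: "inner_sum d (v i) (v j) = of_int (Matrix.row A (js ! i) \<bullet> Matrix.row A (js ! j))" for i j
    unfolding v_def[abs_def] using A by (intro inner_sum_of_int_vec) auto
  have "real_of_int (Determinant.det (chosen_rows A js * transpose_mat (chosen_rows A js)))
      = Determinant.det (map_mat of_int (chosen_rows A js * transpose_mat (chosen_rows A js)))"
    by simp
  also have "map_mat of_int (chosen_rows A js * transpose_mat (chosen_rows A js))
      = Matrix.mat (length js) (length js) (\<lambda>(i, j). inner_sum d (v i) (v j))"
    unfolding chosen_rows_gram[OF A js] by (rule eq_matI) (auto simp: ip)
  also have "Determinant.det \<dots> \<le> (\<Prod>i<length js. t i)"
    by (rule gram_det_le_prod) (use t in \<open>simp only: ip\<close>)
  finally show ?thesis
    by (simp add: volume_def Let_def del: of_int_hom.hom_det)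
qed

section \<open>The hard instances\<close>

locale hard_instance =
  fixes k N Q n :: nat
  assumes k_pos: "k > 0" and rows: "2 * N \<le> n"
begin

text \<open>One coordinate per residue class modulo \<open>k\<close>, then for each index below
  \<open>N\<close> a block of \<open>Q\<close> coordinates, one per letter.\<close>

definition d :: nat where "d = k + N * Q"

definition idx :: "nat \<Rightarrow> nat" where "idx r = (if r < N then r else r - N)"

definition sg :: "nat \<Rightarrow> int" where "sg r = (if r < N then 1 else - 1)"

definition slot :: "(nat \<Rightarrow> nat) \<Rightarrow> (nat \<Rightarrow> nat) \<Rightarrow> nat \<Rightarrow> nat" where
  "slot x y r = k + idx r * Q + (if r < N then x (idx r) else y (idx r))"

text \<open>Positions from \<open>2 * N\<close> on are zero rows that fill the matrix up to
  \<open>n\<close> rows. The opposite signs of the players make the two contributions to the inner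
  product cancel on a hit.\<close>

definition row_at :: "(nat \<Rightarrow> nat) \<Rightarrow> (nat \<Rightarrow> nat) \<Rightarrow> nat \<Rightarrow> int Matrix.vec" where
  "row_at x y r =
     (if r < 2 * N then unit_vec d (idx r mod k) + sg r \<cdot>\<^sub>v unit_vec d (slot x y r) else 0\<^sub>v d)"

definition inst :: "(nat \<Rightarrow> nat) \<Rightarrow> (nat \<Rightarrow> nat) \<Rightarrow> int mat" where
  "inst x y = mat_of_rows d (map (row_at x y) [0..<n])"

lemma row_at_carrier [simp]: "row_at x y r \<in> carrier_vec d"
  by (simp add: row_at_def)

lemma inst_carrier: "inst x y \<in> carrier_mat n d"
  unfolding inst_def by auto

lemma dim_row_inst [simp]: "dim_row (inst x y) = n"
  using inst_carrier by auto

lemma row_inst: "r < n \<Longrightarrow> Matrix.row (inst x y) r = row_at x y r"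
  unfolding inst_def by (subst mat_of_rows_row) auto

lemma idx_less: "r < 2 * N \<Longrightarrow> idx r < N"
  by (auto simp: idx_def)

lemma idx_mod_less: "idx r mod k < k"
  using k_pos by simp

lemma slot_ge: "k \<le> slot x y r"
  by (simp add: slot_def)

lemma mult_add_less:
  assumes "i < N" "q < Q"
  shows "i * Q + q < N * Q"
proof -
  have "i * Q + q < Suc i * Q" using assms by simp
  also have "\<dots> \<le> N * Q" using assms by (intro mult_le_mono1) simp
  finally show ?thesis .
qed

lemma idx_eq_cases:
  "idx r = idx s \<Longrightarrow> r \<noteq> s \<Longrightarrow> r < N \<and> s \<ge> N \<or> s < N \<and> r \<ge> N"
  by (auto simp: idx_def split: if_splits)

context
  fixes x y :: "nat \<Rightarrow> nat"
  assumes x: "\<And>j. j < N \<Longrightarrow> x j < Q" and y: "\<And>j. j < N \<Longrightarrow> y j < Q"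
begin

lemma slot_less: "r < 2 * N \<Longrightarrow> slot x y r < d"
  using idx_less[of r] x[of "idx r"] y[of "idx r"]
  by (auto simp: slot_def d_def add.assoc mult_add_less)

lemma slot_eq_iff:
  assumes "r < 2 * N" "s < 2 * N" "r \<noteq> s"
  shows "slot x y r = slot x y s \<longleftrightarrow> idx r = idx s \<and> x (idx r) = y (idx r)"
proof -
  define v where "v r = (if r < N then x (idx r) else y (idx r))" for r
  have v: "v r < Q" "v s < Q"
    using x y assms idx_less by (auto simp: v_def)
  have "slot x y r = slot x y s \<longleftrightarrow> idx r * Q + v r = idx s * Q + v s"
    by (simp add: slot_def v_def)
  also have "\<dots> \<longleftrightarrow> idx r = idx s \<and> v r = v s"
  proof
    assume eq: "idx r * Q + v r = idx s * Q + v s"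
    then have "(idx r * Q + v r) div Q = (idx s * Q + v s) div Q" by simp
    with v have "idx r = idx s" by simp
    with eq show "idx r = idx s \<and> v r = v s" by simp
  qed simp
  also have "\<dots> \<longleftrightarrow> idx r = idx s \<and> x (idx r) = y (idx r)"
    using idx_eq_cases[of r s] assms by (auto simp: v_def)
  finally show ?thesis .
qed

lemma row_at_index:
  assumes "c < d"
  shows "vec_index (row_at x y r) c =
    (if r < 2 * N then of_bool (c = idx r mod k) + sg r * of_bool (c = slot x y r) else 0)"
  using assms by (auto simp: row_at_def unit_vec_def)

lemma inner_row_at:
  assumes r: "r < 2 * N" and s: "s < 2 * N"
  shows "row_at x y r \<bullet> row_at x y s
    = of_bool (idx r mod k = idx s mod k) + sg r * sg s * of_bool (slot x y r = slot x y s)"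
proof -
  have lt: "idx r mod k < d" "slot x y r < d"
    using idx_mod_less[of r] slot_less[OF r] by (auto simp: d_def)
  have ne: "idx r mod k \<noteq> slot x y s" "slot x y r \<noteq> idx s mod k"
    using idx_mod_less[of r] idx_mod_less[of s] slot_ge[of x y r] slot_ge[of x y s] by linarith+
  have "row_at x y r \<bullet> row_at x y s
      = (unit_vec d (idx r mod k) + sg r \<cdot>\<^sub>v unit_vec d (slot x y r)) \<bullet> row_at x y s"
    using r by (simp add: row_at_def)
  also have "\<dots> = vec_index (row_at x y s) (idx r mod k) + sg r * vec_index (row_at x y s) (slot x y r)"
    using lt by (subst add_scalar_prod_distrib[of _ d])
      (auto simp: scalar_prod_left_unit smult_scalar_prod_distrib[of _ d])
  also have "\<dots> = of_bool (idx r mod k = idx s mod k) + sg r * (sg s * of_bool (slot x y r = slot x y s))"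
    using lt ne s by (simp add: row_at_index)
  finally show ?thesis by simp
qed

lemma sg_square [simp]: "sg r * sg r = 1"
  by (simp add: sg_def)

lemma inst_bounded: "B \<ge> 1 \<Longrightarrow> inst x y \<in> bounded_int_mats n d B"
proof -
  assume B: "B \<ge> 1"
  have "\<bar>inst x y $$ (i, j)\<bar> \<le> int B" if "i < n" "j < d" for i j
  proof -
    have "inst x y $$ (i, j) = vec_index (Matrix.row (inst x y) i) j"
      using that inst_carrier[of x y] by (subst index_row) auto
    also have "\<dots> = (if i < 2 * N then of_bool (j = idx i mod k) + sg i * of_bool (j = slot x y i) else 0)"
      using that by (simp add: row_inst row_at_index)
    finally show ?thesis
      using B idx_mod_less[of i] slot_ge[of x y i] by (auto simp: sg_def)
  qed
  then show ?thesis
    using inst_carrier by (auto simp: bounded_int_mats_def)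
qed

text \<open>An index below \<open>N\<close> is also the position of Alice's row, so
  \<open>hits (set js)\<close> counts chosen rows of Alice. Every chosen hit pair contains such a
  row.\<close>

definition hits :: "nat set \<Rightarrow> nat set" where
  "hits J = {j \<in> J. j < N \<and> x j = y j}"

text \<open>Factor 2 is charged to the first chosen row of each class (\<open>F\<close>, at most
  \<open>k\<close> rows) and to the second row of a hit pair (\<open>E\<close>, at most one per
  hit). Any other nonzero row follows a row with which it has inner product 1, so its squared
  distance to the preceding span is at most 3/2; zero rows fit this bound too.\<close>

lemma volume_inst_le:
  assumes js: "js \<in> row_choices n (2 * k)"
  shows "volume (inst x y) js \<le> sqrt (4 ^ k * (3 / 4) ^ (k - card (hits (set js))))"
proof -
  have len: "length js = 2 * k" and dist: "distinct js" and sub: "set js \<subseteq> {..<n}"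
    using js by (auto simp: row_choices_def)
  let ?b = "\<lambda>i. idx (js ! i) mod k"
  define F where "F = {i. i < 2 * k \<and> js ! i < 2 * N \<and> (\<forall>l<i. \<not> (js ! l < 2 * N \<and> ?b l = ?b i))}"
  define E where "E = {i. i < 2 * k \<and> js ! i < 2 * N \<and>
    (\<exists>l<i. js ! l < 2 * N \<and> idx (js ! l) = idx (js ! i) \<and> x (idx (js ! i)) = y (idx (js ! i)))}"
  define t :: "nat \<Rightarrow> real" where "t i = (if i \<in> F \<union> E then 2 else 3 / 2)" for i
  have fin: "finite F" "finite E" by (simp_all add: F_def E_def)
  have rowjs: "Matrix.row (inst x y) (js ! i) = row_at x y (js ! i)" if "i < 2 * k" for i
    using that len sub nth_mem[of i js] by (intro row_inst) (metis lessThan_iff subsetD)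
  have "volume (inst x y) js \<le> sqrt (\<Prod>i<length js. t i)"
  proof (rule volume_le_sqrt_prod[OF inst_carrier sub])
    fix i assume "i < length js"
    then have i: "i < 2 * k" by (simp add: len)
    have self: "row_at x y (js ! l) \<bullet> row_at x y (js ! l) = 2" if "js ! l < 2 * N" for l
      using that by (simp add: inner_row_at)
    show "\<exists>j r. (r = 0 \<or> j < i) \<and>
      of_int (Matrix.row (inst x y) (js ! i) \<bullet> Matrix.row (inst x y) (js ! i))
      - 2 * r * of_int (Matrix.row (inst x y) (js ! i) \<bullet> Matrix.row (inst x y) (js ! j))
      + r\<^sup>2 * of_int (Matrix.row (inst x y) (js ! j) \<bullet> Matrix.row (inst x y) (js ! j)) \<le> t i"
    proof (cases "js ! i < 2 * N \<and> i \<notin> F \<union> E")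
      case False
      have "real_of_int (Matrix.row (inst x y) (js ! i) \<bullet> Matrix.row (inst x y) (js ! i)) \<le> t i"
      proof (cases "js ! i < 2 * N")
        case True
        with False show ?thesis by (simp add: rowjs[OF i] self t_def)
      next
        case False
        then have "row_at x y (js ! i) \<bullet> row_at x y (js ! i) = 0" by (simp add: row_at_def)
        then show ?thesis by (simp add: rowjs[OF i] t_def)
      qed
      then show ?thesis by (intro exI[of _ 0]) simp
    next
      case True
      then obtain l where l: "l < i" "js ! l < 2 * N" "?b l = ?b i"
        using i by (auto simp: F_def)
      have ne: "js ! i \<noteq> js ! l"
        using dist len i l by (simp add: nth_eq_iff_index_eq)
      have "slot x y (js ! i) \<noteq> slot x y (js ! l)"
        using True i l ne by (subst slot_eq_iff) (auto simp: E_def)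
      with l True have "row_at x y (js ! i) \<bullet> row_at x y (js ! l) = 1"
        by (simp add: inner_row_at)
      \<comment> \<open>Half of the earlier row is the projection onto it, at squared distance 2 - 1
        + 1/2.\<close>
      then show ?thesis
        using l True i by (intro exI[of _ l] exI[of _ "1 / 2"]) (simp add: rowjs self t_def power2_eq_square)
    qed
  qed
  also have "(\<Prod>i<length js. t i) = 2 ^ card (F \<union> E) * (3 / 2) ^ (2 * k - card (F \<union> E))"
  proof -
    have sub2: "F \<union> E \<subseteq> {..<2 * k}" by (auto simp: F_def E_def)
    have "(\<Prod>i<length js. t i) = (\<Prod>i\<in>{..<2 * k} - (F \<union> E). t i) * (\<Prod>i\<in>F \<union> E. t i)"
      unfolding len by (rule prod.subset_diff[OF sub2]) simp
    also have "(\<Prod>i\<in>F \<union> E. t i) = (\<Prod>i\<in>F \<union> E. 2)"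
      by (rule prod.cong) (auto simp: t_def)
    also have "(\<Prod>i\<in>{..<2 * k} - (F \<union> E). t i) = (\<Prod>i\<in>{..<2 * k} - (F \<union> E). 3 / 2)"
      by (rule prod.cong) (auto simp: t_def)
    finally show ?thesis
      using sub2 fin by (simp add: card_Diff_subset)
  qed
  also have "\<dots> \<le> 4 ^ k * (3 / 4) ^ (k - card (hits (set js)))"
  proof -
    let ?c = "card (F \<union> E)"
    have dist': "js ! i \<noteq> js ! l" if "l < i" "i < 2 * k" for i l
      using dist len that by (simp add: nth_eq_iff_index_eq)
    have "inj_on ?b F"
      by (rule linorder_inj_onI) (auto simp: F_def)
    moreover have "?b ` F \<subseteq> {..<k}"
      using k_pos by auto
    ultimately have cF: "card F \<le> k"
      using card_inj_on_le[of ?b F "{..<k}"] by simp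
    \<comment> \<open>Only two positions share an index, so a hit contributes at most one element to
      \<open>E\<close>.\<close>
    have three: False if "idx r = idx s" "idx r = idx u" "r \<noteq> s" "r \<noteq> u" "s \<noteq> u" for r s u
      using that by (auto simp: idx_def split: if_splits)
    have "inj_on (\<lambda>i. idx (js ! i)) E"
    proof (rule linorder_inj_onI)
      fix i i' assume i: "i < i'" "i \<in> E" "i' \<in> E"
      then obtain l where "l < i" "idx (js ! l) = idx (js ! i)"
        by (auto simp: E_def)
      with i show "idx (js ! i) \<noteq> idx (js ! i')"
        using three[of "js ! i" "js ! l" "js ! i'"] dist'[of l i] dist'[of i i'] dist'[of l i']
        by (auto simp: E_def)
    qed auto
    moreover have "(\<lambda>i. idx (js ! i)) ` E \<subseteq> hits (set js)"
    proof safe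
      fix i assume "i \<in> E"
      then obtain l where i: "i < 2 * k" "js ! i < 2 * N" "x (idx (js ! i)) = y (idx (js ! i))"
        and l: "l < i" "idx (js ! l) = idx (js ! i)"
        by (auto simp: E_def)
      have "js ! i < N \<or> js ! l < N"
        using idx_eq_cases[OF l(2)] dist'[OF l(1) i(1)] by auto
      then have "idx (js ! i) = js ! i \<or> idx (js ! i) = js ! l"
        using l(2) by (metis idx_def)
      then have "idx (js ! i) \<in> set js"
        using i(1) l(1) len by (metis less_trans nth_mem)
      with i show "idx (js ! i) \<in> hits (set js)"
        by (simp add: hits_def idx_less)
    qed
    moreover have "finite (hits (set js))" by (simp add: hits_def)
    ultimately have "card E \<le> card (hits (set js))"
      by (intro card_inj_on_le)
    then have c: "?c \<le> k + card (hits (set js))"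
      using cF card_Un_le[of F E] by linarith
    have "?c \<le> card {..<2 * k}"
      by (rule card_mono) (auto simp: F_def E_def)
    then have "(2::real) ^ ?c * (3 / 2) ^ (2 * k - ?c) = 2 ^ (?c + (2 * k - ?c)) * (3 / 4) ^ (2 * k - ?c)"
      by (simp only: power_add mult.assoc power_mult_distrib[symmetric]) simp
    also have "\<dots> = 4 ^ k * (3 / 4) ^ (2 * k - ?c)"
      using \<open>?c \<le> card {..<2 * k}\<close> by (simp add: power_mult)
    also have "\<dots> \<le> 4 ^ k * (3 / 4) ^ (k - card (hits (set js)))"
      using c by (intro mult_left_mono power_decreasing) auto
    finally show ?thesis .
  qed
  finally show ?thesis by simp
qed

text \<open>The two rows at each \<open>P b\<close> are orthogonal by the hit, and rows of different
  classes share no coordinate. The Gram matrix is twice the identity.\<close>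

lemma planted_max_volume:
  assumes P: "\<And>b. b < k \<Longrightarrow> P b < N \<and> P b mod k = b \<and> x (P b) = y (P b)"
  shows "2 ^ k \<le> max_volume (inst x y) (2 * k)"
proof -
  define js where "js = map P [0..<k] @ map (\<lambda>b. N + P b) [0..<k]"
  have set_js: "r \<in> set js \<longleftrightarrow> (\<exists>b<k. r = P b \<or> r = N + P b)" for r
    by (auto simp: js_def)
  have inj: "inj_on P {0..<k}"
    using P by (metis atLeastLessThan_iff inj_onI)
  have P_less: "P b < N" if "b < k" for b
    using P[OF that] by simp
  have "P b \<noteq> N + P c" if "b < k" for b c
    using P_less[OF that] by simp
  then have "distinct js"
    using inj by (auto simp: js_def distinct_map inj_on_def)
  have js_less: "r < 2 * N" if r: "r \<in> set js" for r
  proof -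
    obtain b where "b < k" "r = P b \<or> r = N + P b"
        using r by (auto simp only: set_js)
    with P_less[of b] show ?thesis by auto
  qed
  then have sub: "set js \<subseteq> {..<n}"
    using rows by fastforce
  with \<open>distinct js\<close> have js: "js \<in> row_choices n (2 * k)"
    by (simp add: row_choices_def js_def)
  have ip: "row_at x y r \<bullet> row_at x y s = (if r = s then 2 else 0)" if "r \<in> set js" "s \<in> set js" for r s
  proof -
    have lt: "r < 2 * N" "s < 2 * N"
      using that js_less by auto
    have props: "idx u = P (idx u mod k) \<and> x (idx u) = y (idx u)" if u: "u \<in> set js" for u
    proof -
      obtain b where b: "b < k" "u = P b \<or> u = N + P b"
          using u by (auto simp only: set_js)
      then have "idx u = P b"
        using P_less[of b] by (auto simp: idx_def)
      with P[OF b(1)] show ?thesis by simp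
    qed
    show ?thesis
    proof (cases "r = s")
      case True
      with lt show ?thesis by (simp add: inner_row_at)
    next
      case False
      have "idx r mod k = idx s mod k \<longleftrightarrow> idx r = idx s"
        using props[OF that(1)] props[OF that(2)] by metis
      then show ?thesis
        using lt False props[OF that(1)] idx_eq_cases[of r s]
        by (auto simp: inner_row_at slot_eq_iff sg_def)
    qed
  qed
  have len: "length js = 2 * k" by (simp add: js_def)
  have "chosen_rows (inst x y) js * transpose_mat (chosen_rows (inst x y) js) = 2 \<cdot>\<^sub>m 1\<^sub>m (2 * k)"
    unfolding chosen_rows_gram[OF inst_carrier sub]
  proof (rule eq_matI)
    fix i j assume "i < dim_row (2 \<cdot>\<^sub>m 1\<^sub>m (2 * k) :: int mat)" "j < dim_col (2 \<cdot>\<^sub>m 1\<^sub>m (2 * k) :: int mat)"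
    then have ij: "i < length js" "j < length js" by (simp_all add: len)
    then have "js ! i < n" "js ! j < n"
      using sub nth_mem by blast+
    with ij show "Matrix.mat (length js) (length js)
        (\<lambda>(i, j). Matrix.row (inst x y) (js ! i) \<bullet> Matrix.row (inst x y) (js ! j)) $$ (i, j)
        = (2 \<cdot>\<^sub>m 1\<^sub>m (2 * k)) $$ (i, j)"
      using \<open>distinct js\<close> by (simp add: row_inst ip nth_eq_iff_index_eq len)
  qed (simp_all add: len)
  then have "volume (inst x y) js = 2 ^ k"
    by (simp add: volume_def Let_def power_mult real_sqrt_power)
  with volume_le_max_volume[of js "inst x y" "2 * k"] js show ?thesis
    by simp
qed

lemma approx_imp_hits:
  assumes P: "\<And>b. b < k \<Longrightarrow> P b < N \<and> P b mod k = b \<and> x (P b) = y (P b)"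
    and js: "js \<in> row_choices n (2 * k)"
    and le: "max_volume (inst x y) (2 * k) \<le> (16 / 15) ^ k * volume (inst x y) js"
  shows "k \<le> 2 * card (hits (set js))"
proof (rule ccontr)
  define h where "h = card (hits (set js))"
  assume "\<not> k \<le> 2 * card (hits (set js))"
  then have h: "2 * (k - h) \<ge> k" by (simp add: h_def)
  have sq: "(z ^ k)\<^sup>2 = (z\<^sup>2) ^ k" for z :: real
    by (metis mult.commute power_mult)
  have "2 ^ k \<le> (16 / 15) ^ k * volume (inst x y) js"
    using planted_max_volume[OF P] le by linarith
  also have "\<dots> \<le> (16 / 15) ^ k * sqrt (4 ^ k * (3 / 4) ^ (k - h))"
    unfolding h_def by (intro mult_left_mono volume_inst_le js) auto
  finally have "((2::real) ^ k)\<^sup>2 \<le> ((16 / 15) ^ k * sqrt (4 ^ k * (3 / 4) ^ (k - h)))\<^sup>2"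
    by (intro power_mono) auto
  also have "\<dots> = (2 ^ k)\<^sup>2 * ((256 / 225) ^ k * (3 / 4) ^ (k - h))"
  proof -
    have "(16 / 15 :: real)\<^sup>2 = 256 / 225" "(2 :: real)\<^sup>2 = 4"
      by (simp_all add: power_divide)
    moreover have "(sqrt (4 ^ k * (3 / 4) ^ (k - h)))\<^sup>2 = 4 ^ k * (3 / 4 :: real) ^ (k - h)"
      by (rule real_sqrt_pow2) simp
    ultimately show ?thesis
      by (simp only: power_mult_distrib sq mult.left_commute)
  qed
  finally have "1 \<le> (256 / 225 :: real) ^ k * (3 / 4) ^ (k - h)"
    by simp
  \<comment> \<open>Squaring again doubles the exponent \<open>k - h\<close>, which can then be
    replaced by \<open>k\<close>; what remains is (256/225)^2 * (3/4) < 1.\<close>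
  then have "1\<^sup>2 \<le> ((256 / 225 :: real) ^ k * (3 / 4) ^ (k - h))\<^sup>2"
    by (intro power_mono) auto
  also have "\<dots> = ((256 / 225)\<^sup>2) ^ k * (3 / 4) ^ (2 * (k - h))"
    by (simp add: power_mult_distrib mult.commute flip: power_mult)
  also have "\<dots> \<le> ((256 / 225)\<^sup>2) ^ k * (3 / 4) ^ k"
    using h by (intro mult_left_mono power_decreasing) auto
  also have "\<dots> = ((256 / 225)\<^sup>2 * (3 / 4)) ^ k"
    by (simp only: power_mult_distrib)
  also have "\<dots> < 1"
    using k_pos by (intro power_less_one_iff[THEN iffD2] ) (auto simp: power2_eq_square)
  finally show False by simp
qed

end

end

section \<open>Random transversals\<close>

definition transversals :: "nat \<Rightarrow> nat \<Rightarrow> (nat \<Rightarrow> nat) set" where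
  "transversals k N = (\<Pi>\<^sub>E b\<in>{..<k}. {j \<in> {..<N}. j mod k = b})"

lemma card_residue_class:
  assumes "b < k"
  shows "card {j \<in> {..<k * m}. j mod k = b} = m"
proof -
  have "{j \<in> {..<k * m}. j mod k = b} = (\<lambda>i. i * k + b) ` {..<m}"
  proof safe
    fix j assume j: "j < k * m" "b = j mod k"
    then have "j div k < m"
      by (simp add: less_mult_imp_div_less mult.commute)
    then show "j \<in> (\<lambda>i. i * k + j mod k) ` {..<m}"
      by (intro image_eqI[of _ _ "j div k"]) auto
  next
    fix i assume "i < m"
    then have "i * k + b < Suc i * k" "Suc i * k \<le> m * k"
      using assms by (simp, intro mult_le_mono1) simp
    then show "i * k + b < k * m" by (simp add: mult.commute)
  qed (use assms in simp)
  moreover have "inj_on (\<lambda>i. i * k + b) {..<m}"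
    using assms by (auto intro!: inj_onI)
  ultimately show ?thesis
    by (simp add: card_image)
qed

lemma finite_transversals [simp]: "finite (transversals k N)"
  by (auto simp: transversals_def intro: finite_PiE)

lemma transversals_nonempty: "m > 0 \<Longrightarrow> transversals k (k * m) \<noteq> {}"
  unfolding transversals_def PiE_eq_empty_iff using card_residue_class[of _ k m]
  by (metis card.empty lessThan_iff less_irrefl)

lemma transversal_cong:
  "P \<in> transversals k N \<Longrightarrow> b < k \<Longrightarrow> P b < N \<and> P b mod k = b"
  by (auto simp: transversals_def PiE_iff)

text \<open>Exchanging \<open>P b\<close> with the extra element \<open>i\<close> of its class is an
  involution on pairs \<open>(P, i)\<close>.\<close>

lemma sum_transversals_swap:
  assumes "b < k"
  shows "(\<Sum>P\<in>transversals k N. \<Sum>i\<in>{j \<in> {..<N}. j mod k = b}. h (P(b := i)) (P b))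
    = (\<Sum>P\<in>transversals k N. \<Sum>i\<in>{j \<in> {..<N}. j mod k = b}. (h P i :: real))"
proof -
  let ?C = "{j \<in> {..<N}. j mod k = b}"
  have upd: "P(b := i) \<in> transversals k N" "P b \<in> ?C"
    if "P \<in> transversals k N" "i \<in> ?C" for P i
    using that assms by (auto simp: transversals_def PiE_iff extensional_def)
  have "(\<Sum>z\<in>transversals k N \<times> ?C. h ((fst z)(b := snd z)) (fst z b))
      = (\<Sum>z\<in>transversals k N \<times> ?C. h (fst z) (snd z))"
    by (rule sum.reindex_bij_witness[where i = "\<lambda>(P, i). (P(b := i), P b)"
          and j = "\<lambda>(P, i). (P(b := i), P b)"]) (use upd in \<open>fastforce+\<close>)
  then show ?thesis
    by (simp only: sum.cartesian_product split_def)
qed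

text \<open>Enlarging a transversal \<open>P\<close> by a further element \<open>i\<close> of the class \<open>b\<close> gives the same
  set as enlarging \<open>P(b := i)\<close> by \<open>P b\<close>. So \<open>\<Phi>\<close> hardly changes when \<open>P b\<close> is replaced by an
  independent element, which makes the argument \<open>P b\<close> independent of the set.\<close>

lemma sum_transversals_le:
  fixes \<Phi> \<Delta> :: "nat set \<Rightarrow> nat \<Rightarrow> real" and c \<epsilon> :: real and k m N :: nat
  assumes k: "k > 0" and N: "N = k * m"
    and step: "\<And>S i j. \<bar>\<Phi> (insert j S) i - \<Phi> S i\<bar> \<le> \<Delta> S j"
    and \<Delta>: "\<And>S. (\<Sum>j<N. \<Delta> S j) \<le> \<epsilon>"
    and \<Phi>: "\<And>S. (\<Sum>j<N. \<Phi> S j) \<le> c"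
  shows "m * (\<Sum>P\<in>transversals k (N). \<Sum>b<k. \<Phi> (P ` {..<k}) (P b))
    \<le> card (transversals k (N)) * (c + 2 * \<epsilon>)"
proof -
  let ?T = "transversals k (N)"
  let ?C = "\<lambda>b. {j \<in> {..<N}. j mod k = b}"
  let ?S = "\<lambda>P. P ` {..<k}"
  have group: "(\<Sum>b<k. \<Sum>i\<in>?C b. h i) = (\<Sum>j<N. h j)" for h :: "nat \<Rightarrow> real"
    by (rule sum.group) (use k in auto)
  have le: "\<Phi> (?S P) (P b) \<le> \<Phi> (?S (P(b := i))) (P b) + \<Delta> (?S P) i + \<Delta> (?S (P(b := i))) (P b)"
    if "b < k" for P b i
  proof -
    have "insert i (?S P) = insert (P b) (?S (P(b := i)))"
      using that by auto
    then show ?thesis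
      using step[of i "?S P" "P b"] step[of "P b" "?S (P(b := i))" "P b"] by simp
  qed
  have "m * (\<Sum>P\<in>?T. \<Sum>b<k. \<Phi> (?S P) (P b)) = (\<Sum>P\<in>?T. \<Sum>b<k. \<Sum>i\<in>?C b. \<Phi> (?S P) (P b))"
    by (simp add: N card_residue_class[simplified] sum_distrib_left)
  also have "\<dots> \<le> (\<Sum>P\<in>?T. \<Sum>b<k. \<Sum>i\<in>?C b.
      \<Phi> (?S (P(b := i))) (P b) + \<Delta> (?S P) i + \<Delta> (?S (P(b := i))) (P b))"
    by (intro sum_mono le) auto
  also have "\<dots> = (\<Sum>b<k. \<Sum>P\<in>?T. \<Sum>i\<in>?C b. \<Phi> (?S (P(b := i))) (P b))
      + (\<Sum>b<k. \<Sum>P\<in>?T. \<Sum>i\<in>?C b. \<Delta> (?S P) i)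
      + (\<Sum>b<k. \<Sum>P\<in>?T. \<Sum>i\<in>?C b. \<Delta> (?S (P(b := i))) (P b))"
    by (subst sum.swap) (simp only: sum.distrib)
  also have "\<dots> = (\<Sum>b<k. \<Sum>P\<in>?T. \<Sum>i\<in>?C b. \<Phi> (?S P) i)
      + (\<Sum>b<k. \<Sum>P\<in>?T. \<Sum>i\<in>?C b. \<Delta> (?S P) i)
      + (\<Sum>b<k. \<Sum>P\<in>?T. \<Sum>i\<in>?C b. \<Delta> (?S P) i)"
  proof -
    have "(\<Sum>P\<in>?T. \<Sum>i\<in>?C b. h (?S (P(b := i))) (P b)) = (\<Sum>P\<in>?T. \<Sum>i\<in>?C b. h (?S P) i)"
      if "b < k" for h :: "nat set \<Rightarrow> nat \<Rightarrow> real" and b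
      using sum_transversals_swap[OF that, of "\<lambda>P. h (?S P)"] .
    then show ?thesis by simp
  qed
  \<comment> \<open>With \<open>P b\<close> replaced by a free element of its class, the classes
    reassemble into sums over all \<open>j < N\<close> for one fixed set.\<close>
  also have "\<dots> = (\<Sum>P\<in>?T. (\<Sum>j<N. \<Phi> (?S P) j) + 2 * (\<Sum>j<N. \<Delta> (?S P) j))"
    by (simp only: sum.swap[of _ ?T] group sum.distrib sum_distrib_left[symmetric])
  also have "\<dots> \<le> (\<Sum>P\<in>?T. c + 2 * \<epsilon>)"
    by (intro sum_mono add_mono mult_left_mono \<Phi> \<Delta>) auto
  finally show ?thesis by simp
qed

text \<open>The easy direction of Yao's principle. The best \<open>D\<close> exists even for
  infinite support, since success counts are natural numbers bounded by
  \<open>card \<Omega>\<close>.\<close>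

lemma pmf_averaging:
  assumes fin: "finite \<Omega>" and prob: "\<And>\<omega>. \<omega> \<in> \<Omega> \<Longrightarrow> measure_pmf.prob R {D. ok D \<omega>} \<ge> \<delta>"
  shows "\<exists>D\<in>set_pmf R. \<delta> * card \<Omega> \<le> (\<Sum>\<omega>\<in>\<Omega>. of_bool (ok D \<omega>))"
proof -
  define f :: "_ \<Rightarrow> nat" where "f D = (\<Sum>\<omega>\<in>\<Omega>. of_bool (ok D \<omega>))" for D
  have f_le: "f D \<le> card \<Omega>" for D
    unfolding f_def using sum_bounded_above[of \<Omega> "\<lambda>\<omega>. of_bool (ok D \<omega>)" "1 :: nat"] by simp
  obtain D0 where D0: "D0 \<in> set_pmf R" and max: "\<And>D. D \<in> set_pmf R \<Longrightarrow> f D \<le> f D0"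
  proof -
    obtain D1 where "D1 \<in> set_pmf R" using set_pmf_not_empty by fast
    then show ?thesis
      using ex_has_greatest_nat[of "\<lambda>D. D \<in> set_pmf R" D1 f "Suc (card \<Omega>)"] f_le that
      by (metis le_imp_less_Suc)
  qed
  have int: "integrable (measure_pmf R) (\<lambda>D. indicator {D. ok D \<omega>} D :: real)" for \<omega>
    by (rule measure_pmf.integrable_const_bound[of _ 1]) auto
  have "\<delta> * card \<Omega> \<le> (\<Sum>\<omega>\<in>\<Omega>. measure_pmf.prob R {D. ok D \<omega>})"
    using sum_bounded_below[of \<Omega> \<delta> "\<lambda>\<omega>. measure_pmf.prob R {D. ok D \<omega>}"] prob by (simp add: mult.commute)
  also have "\<dots> = (\<integral>D. (\<Sum>\<omega>\<in>\<Omega>. indicator {D. ok D \<omega>} D) \<partial>measure_pmf R)"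
    using int by (simp add: Bochner_Integration.integral_sum)
  also have "\<dots> \<le> real (f D0)"
  proof (rule measure_pmf.integral_le_const)
    show "integrable (measure_pmf R) (\<lambda>D. \<Sum>\<omega>\<in>\<Omega>. indicator {D. ok D \<omega>} D :: real)"
      using int by (intro Bochner_Integration.integrable_sum)
    have "(\<Sum>\<omega>\<in>\<Omega>. indicator {D. ok D \<omega>} D) = real (f D)" for D
      by (simp add: f_def indicator_def)
    then show "AE D in measure_pmf R. (\<Sum>\<omega>\<in>\<Omega>. indicator {D. ok D \<omega>} D) \<le> real (f D0)"
      using max by (simp add: AE_measure_pmf_iff)
  qed
  finally show ?thesis
    using D0 by (intro bexI[of _ D0]) (simp_all add: f_def)
qed

section \<open>Streaming algorithms on the hard instances\<close>

context hard_instance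
begin

text \<open>The index must be read off the output alone, so that it is a function of the transcript.
  A row of Alice given by its entries has a single 1 among the letter blocks, and the block tells
  the index. Other references may yield arbitrary values; they only enter the count of at most
  \<open>2 * k\<close>.\<close>

fun named_row :: "row_ref \<Rightarrow> nat" where
  "named_row (Position i) = i"
| "named_row (Entries v) = (SOME j. j < N \<and> (\<exists>q<Q. vec_index v (k + j * Q + q) = 1))"

text \<open>Truncation bounds the count also for malformed, overlong outputs.\<close>

definition named :: "row_ref list \<Rightarrow> nat set" where
  "named rs = named_row ` set (take (2 * k) rs)"

lemma card_named_le: "card (named rs) \<le> 2 * k"
proof -
  have "card (named rs) \<le> card (set (take (2 * k) rs))"
    unfolding named_def by (rule card_image_le) simp
  also have "\<dots> \<le> 2 * k"
    by (rule order_trans[OF card_length]) simp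
  finally show ?thesis .
qed

lemma finite_named [simp]: "finite (named rs)"
  by (simp add: named_def)

lemma named_row_eq:
  assumes x: "\<And>j. j < N \<Longrightarrow> x j < Q" and y: "\<And>j. j < N \<Longrightarrow> y j < Q"
    and "refers_to (inst x y) r j" "j < N"
  shows "named_row r = j"
proof (cases r)
  case (Position i)
  with assms show ?thesis by simp
next
  case (Entries v)
  have jn: "j < n" using \<open>j < N\<close> rows by simp
  have ind: "vec_index v (k + i * Q + q) = (of_bool (k + i * Q + q = slot x y j) :: int)"
    if "i < N" "q < Q" for i q
  proof -
    have "k + i * Q + q < d"
      using mult_add_less[OF that] by (simp add: d_def)
    moreover have "k + i * Q + q \<noteq> idx j mod k"
      using idx_mod_less[of j] by linarith
    ultimately show ?thesis
      using assms(3) \<open>j < N\<close> Entries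
      by (simp add: row_inst[OF jn] row_at_index[OF x y] sg_def)
  qed
  have "i = j" if "i < N" "q < Q" "vec_index v (k + i * Q + q) = 1" for i q
  proof -
    have "i * Q + q = j * Q + x j"
      using ind[OF that(1,2)] that(3) \<open>j < N\<close> by (simp add: slot_def idx_def split: if_splits)
    then have "(i * Q + q) div Q = (j * Q + x j) div Q" by simp
    with that x[OF \<open>j < N\<close>] show ?thesis by simp
  qed
  moreover have "vec_index v (k + j * Q + x j) = 1"
    using ind[OF \<open>j < N\<close> x[OF \<open>j < N\<close>]] \<open>j < N\<close> by (simp add: slot_def idx_def)
  ultimately have "(SOME j. j < N \<and> (\<exists>q<Q. vec_index v (k + j * Q + q) = 1)) = j"
    using x[OF \<open>j < N\<close>] \<open>j < N\<close> by (intro some_equality) blast+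
  with Entries show ?thesis by simp
qed

lemma approx_output_imp_named:
  assumes x: "\<And>j. j < N \<Longrightarrow> x j < Q" and y: "\<And>j. j < N \<Longrightarrow> y j < Q"
    and P: "\<And>b. b < k \<Longrightarrow> P b < N \<and> P b mod k = b \<and> x (P b) = y (P b)"
    and out: "approx_output (inst x y) (2 * k) ((16 / 15) ^ k) rs"
  shows "k \<le> 2 * card {j \<in> named rs. j < N \<and> x j = y j}"
proof -
  obtain js where js: "js \<in> row_choices n (2 * k)" and ref: "list_all2 (refers_to (inst x y)) rs js"
    and le: "max_volume (inst x y) (2 * k) \<le> (16 / 15) ^ k * volume (inst x y) js"
    using out by (auto simp: approx_output_def)
  have len: "length rs = length js" "length js = 2 * k"
    using ref js by (auto simp: list_all2_lengthD row_choices_def)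
  have "j \<in> named rs" if j: "j \<in> set js" "j < N" for j
  proof -
    obtain i where i: "i < length js" "js ! i = j"
      using j(1) by (auto simp: in_set_conv_nth)
    have "refers_to (inst x y) (rs ! i) j"
      using list_all2_nthD2[OF ref i(1)] i(2) by simp
    then have "named_row (rs ! i) = j"
      using named_row_eq[of x y "rs ! i" j] x y j(2) by blast
    then show ?thesis
      using i len by (auto simp: named_def intro!: image_eqI[of _ _ "rs ! i"])
  qed
  then have "hits x y (set js) \<subseteq> {j \<in> named rs. j < N \<and> x j = y j}"
    by (auto simp: hits_def[OF x y])
  then have "card (hits x y (set js)) \<le> card {j \<in> named rs. j < N \<and> x j = y j}"
    by (intro card_mono) auto
  with approx_imp_hits[OF x y P js le] show ?thesis
    by linarith
qed

end

section \<open>Two-party simulation of a streaming algorithm\<close>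

locale hard_stream = hard_instance k N Q n + code_space N Q for k N Q n :: nat +
  fixes D :: streaming_alg and p s :: nat
  assumes initial_bits: "length (initial D) = s"
    and update_bits: "length mem = s \<Longrightarrow> length (update D q i r mem) = s"
    and passes: "p \<ge> 1"
begin

text \<open>The constant word is a dummy: rows before \<open>N\<close> do not read the other
  player's word.\<close>

definition alice :: "nat \<Rightarrow> (nat \<Rightarrow> nat) \<Rightarrow> bool list \<Rightarrow> bool list" where
  "alice q x = fold (\<lambda>i. update D q i (row_at x (\<lambda>_. 0) i)) [0..<N]"

definition bob :: "nat \<Rightarrow> (nat \<Rightarrow> nat) \<Rightarrow> bool list \<Rightarrow> bool list" where
  "bob q y = fold (\<lambda>i. update D q i (row_at (\<lambda>_. 0) y i)) [N..<n]"

definition state :: "(nat \<Rightarrow> nat) \<Rightarrow> (nat \<Rightarrow> nat) \<Rightarrow> nat \<Rightarrow> bool list" where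
  "state x y q = fold (run_pass D (inst x y)) [0..<q] (initial D)"

lemma run_pass_inst: "run_pass D (inst x y) q mem = bob q y (alice q x mem)"
proof -
  have "[0..<n] = [0..<N] @ [N..<n]"
    using rows upt_add_eq_append[of 0 N "n - N"] by simp
  moreover have "fold (\<lambda>i. update D q i (Matrix.row (inst x y) i)) [0..<N] mem = alice q x mem" for mem
    unfolding alice_def using rows
    by (intro fold_cong) (auto simp: row_inst row_at_def slot_def idx_def)
  moreover have "fold (\<lambda>i. update D q i (Matrix.row (inst x y) i)) [N..<n] mem = bob q y mem" for mem
    unfolding bob_def by (intro fold_cong) (auto simp: row_inst row_at_def slot_def)
  ultimately show ?thesis
    by (simp add: run_pass_def)
qed

lemma state_Suc: "state x y (Suc q) = bob q y (alice q x (state x y q))"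
  by (simp add: state_def run_pass_inst)

lemma fold_bits: "length mem = s \<Longrightarrow> length (fold (\<lambda>i. update D q i (r i)) is mem) = s"
  by (induction "is" arbitrary: mem) (simp_all add: update_bits)

lemma alice_bits: "length mem = s \<Longrightarrow> length (alice q x mem) = s"
  by (simp add: alice_def fold_bits)

lemma state_bits: "length (state x y q) = s"
proof (induction q)
  case 0
  then show ?case by (simp add: state_def initial_bits)
next
  case (Suc q)
  then show ?case by (simp add: state_Suc bob_def alice_bits fold_bits)
qed

text \<open>Two memory contents per pass: at the handover to Bob and at the end of the pass.\<close>

definition transcripts :: "(nat \<Rightarrow> bool list \<times> bool list) set" where
  "transcripts = PiE {..<p} (\<lambda>_. {l. length l = s} \<times> {l. length l = s})"

definition transcript :: "(nat \<Rightarrow> nat) \<Rightarrow> (nat \<Rightarrow> nat) \<Rightarrow> nat \<Rightarrow> bool list \<times> bool list" where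
  "transcript x y = restrict (\<lambda>q. (alice q x (state x y q), state x y (Suc q))) {..<p}"

definition consistent_a :: "(nat \<Rightarrow> bool list \<times> bool list) \<Rightarrow> (nat \<Rightarrow> nat) \<Rightarrow> real" where
  "consistent_a t x =
     of_bool (\<forall>q<p. alice q x (case q of 0 \<Rightarrow> initial D | Suc q' \<Rightarrow> snd (t q')) = fst (t q))"

definition consistent_b :: "(nat \<Rightarrow> bool list \<times> bool list) \<Rightarrow> (nat \<Rightarrow> nat) \<Rightarrow> real" where
  "consistent_b t y = of_bool (\<forall>q<p. bob q y (fst (t q)) = snd (t q))"

lemma bits_set: "{l :: bool list. length l = s} = {l. set l \<subseteq> UNIV \<and> length l = s}"
  by simp

lemma finite_transcripts: "finite transcripts"
  unfolding transcripts_def bits_set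
  by (intro finite_PiE finite_cartesian_product finite_lists_length_eq) auto

lemma card_transcripts: "card transcripts = 2 ^ (2 * p * s)"
proof -
  have "card {l :: bool list. length l = s} = 2 ^ s"
    unfolding bits_set by (subst card_lists_length_eq) auto
  then have "card transcripts = (2 ^ s * 2 ^ s) ^ p"
    by (simp add: transcripts_def card_PiE card_cartesian_product)
  then show ?thesis
    by (simp only: power_add[symmetric] power_mult[symmetric]) (simp add: algebra_simps)
qed

lemma transcript_in: "transcript x y \<in> transcripts"
  by (auto simp: transcripts_def transcript_def alice_bits state_bits)

text \<open>The rectangle property. Each player checks only the own moves, taking the other's
  messages from \<open>t\<close>; if all moves are right, induction over the passes reproduces the
  actual run from \<open>initial D\<close>.\<close>

lemma consistent_eq:
  assumes t: "t \<in> transcripts"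
  shows "consistent_a t x * consistent_b t y = of_bool (t = transcript x y)"
proof -
  have "t = transcript x y"
    if a: "\<And>q. q < p \<Longrightarrow> alice q x (case q of 0 \<Rightarrow> initial D | Suc q' \<Rightarrow> snd (t q')) = fst (t q)"
      and b: "\<And>q. q < p \<Longrightarrow> bob q y (fst (t q)) = snd (t q)"
  proof -
    have eq: "q < p \<Longrightarrow> t q = (alice q x (state x y q), state x y (Suc q))" for q
    proof (induction q)
      case 0
      have "state x y 0 = initial D" by (simp add: state_def)
      with a[of 0] b[of 0] 0 show ?case
        by (simp add: prod_eq_iff state_Suc)
    next
      case (Suc q)
      then have "snd (t q) = state x y (Suc q)" by simp
      with a[of "Suc q"] b[of "Suc q"] Suc.prems show ?case
        by (simp add: prod_eq_iff state_Suc[of x y "Suc q"])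
    qed
    show ?thesis
      by (rule PiE_ext[OF t[unfolded transcripts_def] transcript_in[unfolded transcripts_def]])
        (simp add: eq transcript_def)
  qed
  moreover have "alice q x (case q of 0 \<Rightarrow> initial D | Suc q' \<Rightarrow> snd (transcript x y q')) = fst (transcript x y q)"
    if "q < p" for q
    using that by (cases q) (simp_all add: transcript_def state_def)
  moreover have "bob q y (fst (transcript x y q)) = snd (transcript x y q)" if "q < p" for q
    using that by (simp add: transcript_def state_Suc)
  ultimately show ?thesis
    by (auto simp: consistent_a_def consistent_b_def)
qed

lemma sum_consistent:
  "(\<Sum>t\<in>transcripts. g t * (consistent_a t x * consistent_b t y)) = g (transcript x y)"
proof -
  have "(\<Sum>t\<in>transcripts. g t * (consistent_a t x * consistent_b t y))
      = (\<Sum>t\<in>transcripts. if t = transcript x y then g t else 0)"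
    by (intro sum.cong) (auto simp: consistent_eq)
  then show ?thesis
    using transcript_in[of x y] finite_transcripts by (simp add: sum.delta')
qed

sublocale rectangle_partition N Q transcripts consistent_a consistent_b
proof unfold_locales
  show "(\<Sum>t\<in>transcripts. consistent_a t x * consistent_b t y) = 1" for x y
    using sum_consistent[of "\<lambda>_. 1" x y] by simp
qed (auto simp: finite_transcripts consistent_a_def consistent_b_def)

definition found :: "nat \<Rightarrow> (nat \<Rightarrow> nat) \<Rightarrow> (nat \<Rightarrow> nat) \<Rightarrow> real" where
  "found j x y = of_bool (j \<in> named (run D p (inst x y)))"

text \<open>The output depends only on the memory after the last pass, which has number
  \<open>p - 1\<close>, so being named is a 0/1 test of the transcript.\<close>

lemma found_eq_sum:
  "found j x y = (\<Sum>t\<in>transcripts.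
     of_bool (j \<in> named (answer D (snd (t (p - 1))))) * (consistent_a t x * consistent_b t y))"
proof -
  have "snd (transcript x y (p - 1)) = state x y p"
    using passes by (simp add: transcript_def)
  then have "run D p (inst x y) = answer D (snd (transcript x y (p - 1)))"
    by (simp add: run_def state_def)
  then show ?thesis
    unfolding sum_consistent by (simp add: found_def)
qed

lemma planted_found_step:
  "\<bar>planted (insert j S) (found i) - planted S (found i)\<bar> \<le> shift S j"
  unfolding found_eq_sum[abs_def] by (rule planted_insert_diff_le) simp

lemma sum_planted_found_le: "(\<Sum>j<N. planted S (found j)) \<le> 2 * k"
proof -
  have "(\<Sum>j<N. found j x y) \<le> 2 * k" for x y
  proof -
    have "(\<Sum>j<N. found j x y) = real (card ({..<N} \<inter> named (run D p (inst x y))))"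
      by (simp add: found_def of_bool_def sum.If_cases Int_def)
    also have "card ({..<N} \<inter> named (run D p (inst x y))) \<le> card (named (run D p (inst x y)))"
      by (intro card_mono) auto
    also have "\<dots> \<le> 2 * k"
      by (rule card_named_le)
    finally show ?thesis by simp
  qed
  then have "planted S (\<lambda>x y. \<Sum>j<N. found j x y) \<le> planted S (\<lambda>x y. 2 * k)"
    by (intro planted_mono)
  then show ?thesis by (simp add: planted_sum)
qed

definition success :: "(nat \<Rightarrow> nat) \<Rightarrow> (nat \<Rightarrow> nat) \<Rightarrow> real" where
  "success x y = of_bool (approx_output (inst x y) (2 * k) ((16 / 15) ^ k) (run D p (inst x y)))"

text \<open>Markov's inequality: success forces at least \<open>k/2\<close> named hits, so its
  indicator is at most \<open>2 / k\<close> times their number. They are planted ones or accidental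
  ones, and at most \<open>N / Q\<close> of the latter are expected in total.\<close>

lemma planted_success_le:
  assumes P: "P \<in> transversals k N"
  shows "planted (P ` {..<k}) success
    \<le> 2 / k * ((\<Sum>b<k. planted (P ` {..<k}) (found (P b))) + N / Q)"
proof -
  let ?S = "P ` {..<k}"
  have "planted ?S success \<le> planted ?S (\<lambda>x y. 2 / k *
      ((\<Sum>b<k. found (P b) x y) + (\<Sum>j\<in>{..<N} - ?S. of_bool (x j = y j))))"
  proof (rule planted_mono)
    fix u x y assume uxy: "u \<in> cube" "x \<in> cube" "y \<in> cube"
    define x' y' where "x' = override ?S u x" and "y' = override ?S u y"
    define rs where "rs = run D p (inst x' y')"
    have x': "x' j < Q" and y': "y' j < Q" if "j < N" for j
      using uxy that unfolding x'_def y'_def by (simp_all add: override_in_cube cube_less)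
    have P': "P b < N \<and> P b mod k = b \<and> x' (P b) = y' (P b)" if "b < k" for b
      using transversal_cong[OF P that] that by (simp add: x'_def y'_def override_def)
    show "success x' y' \<le> 2 / k *
      ((\<Sum>b<k. found (P b) x' y') + (\<Sum>j\<in>{..<N} - ?S. of_bool (x' j = y' j)))" (is "_ \<le> 2 / k * (?F + ?C)")
    proof (cases "approx_output (inst x' y') (2 * k) ((16 / 15) ^ k) rs")
      case False
      then show ?thesis
        by (simp add: success_def rs_def found_def sum_nonneg)
    next
      case True
      have hit: "k \<le> 2 * card {j \<in> named rs. j < N \<and> x' j = y' j}"
        by (rule approx_output_imp_named[where P = P, OF _ _ _ True]) (simp_all add: x' y' P')
      have F: "?F = card {b \<in> {..<k}. P b \<in> named rs}"
        by (simp add: found_def rs_def of_bool_def sum.If_cases Int_def)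
      have C: "?C = card {j \<in> {..<N} - ?S. x' j = y' j}"
        by (simp add: of_bool_def sum.If_cases Int_def)
      have "{j \<in> named rs. j < N \<and> x' j = y' j}
          \<subseteq> P ` {b \<in> {..<k}. P b \<in> named rs} \<union> {j \<in> {..<N} - ?S. x' j = y' j}"
        by auto
      then have "card {j \<in> named rs. j < N \<and> x' j = y' j}
          \<le> card (P ` {b \<in> {..<k}. P b \<in> named rs} \<union> {j \<in> {..<N} - ?S. x' j = y' j})"
        by (intro card_mono) auto
      also have "\<dots> \<le> card {b \<in> {..<k}. P b \<in> named rs} + card {j \<in> {..<N} - ?S. x' j = y' j}"
        by (intro order_trans[OF card_Un_le] add_mono card_image_le) auto
      finally have "k \<le> 2 * (card {b \<in> {..<k}. P b \<in> named rs} + card {j \<in> {..<N} - ?S. x' j = y' j})"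
        by (rule order_trans[OF hit mult_le_mono2])
      from of_nat_mono[OF this, where 'a = real] have "real k \<le> 2 * (?F + ?C)"
        unfolding F C by (simp only: of_nat_mult of_nat_add of_nat_numeral)
      then show ?thesis
        using True k_pos by (simp add: success_def rs_def field_simps)
    qed
  qed
  also have "\<dots> = 2 / k * ((\<Sum>b<k. planted ?S (found (P b)))
      + (\<Sum>j\<in>{..<N} - ?S. planted ?S (\<lambda>x y. of_bool (x j = y j))))"
    by (simp only: planted_cmult planted_add planted_sum)
  also have "\<dots> \<le> 2 / k * ((\<Sum>b<k. planted ?S (found (P b))) + N / Q)"
  proof (intro mult_left_mono add_left_mono)
    have "(\<Sum>j\<in>{..<N} - ?S. planted ?S (\<lambda>x y. of_bool (x j = y j))) = card ({..<N} - ?S) * (1 / Q)"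
      by (simp add: planted_coincidence)
    also have "\<dots> \<le> N * (1 / Q)"
      using card_mono[of "{..<N}" "{..<N} - ?S"] by (intro mult_right_mono) auto
    finally show "(\<Sum>j\<in>{..<N} - ?S. planted ?S (\<lambda>x y. of_bool (x j = y j))) \<le> N / Q"
      by simp
  qed simp
  finally show ?thesis .
qed

text \<open>In the numerator over \<open>m\<close>, \<open>2 * k\<close> pays for guessing: at most
  \<open>2 * k\<close> named rows against one independent element among the \<open>m\<close> of each
  class. The rest pays for adding one hit and removing another.\<close>

lemma sum_planted_success_le:
  fixes \<delta> :: real
  assumes N: "N = k * m" and m: "m > 0" and \<delta>: "\<delta> > 0"
  shows "(\<Sum>P\<in>transversals k N. planted (P ` {..<k}) success)
    \<le> card (transversals k N) * (2 / k * ((2 * k + 2 * (\<delta> * N + 4 * p * s / \<delta>)) / m + N / Q))"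
proof -
  let ?T = "transversals k N"
  let ?\<epsilon> = "\<delta> * N + 4 * p * s / \<delta>"
  have "ln (real (card transcripts)) = 2 * p * s * ln 2"
    by (simp add: card_transcripts ln_realpow)
  also have "\<dots> \<le> real (2 * p * s) * 1"
    using ln_2_less_1 by (intro mult_left_mono) auto
  finally have "2 * ln (real (card transcripts)) / \<delta> \<le> 4 * p * s / \<delta>"
    using \<delta> by (intro divide_right_mono) auto
  then have shift: "(\<Sum>j<N. shift S j) \<le> ?\<epsilon>" for S
    using sum_shift_le[OF \<delta>, of S] by linarith
  have "m * (\<Sum>P\<in>?T. \<Sum>b<k. planted (P ` {..<k}) (found (P b))) \<le> card ?T * (2 * k + 2 * ?\<epsilon>)"
    by (rule sum_transversals_le[OF k_pos N planted_found_step shift sum_planted_found_le])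
  then have found: "(\<Sum>P\<in>?T. \<Sum>b<k. planted (P ` {..<k}) (found (P b))) \<le> card ?T * ((2 * k + 2 * ?\<epsilon>) / m)"
    using m by (simp add: pos_le_divide_eq mult.commute)
  have "(\<Sum>P\<in>?T. planted (P ` {..<k}) success)
      \<le> (\<Sum>P\<in>?T. 2 / k * ((\<Sum>b<k. planted (P ` {..<k}) (found (P b))) + N / Q))"
    by (intro sum_mono planted_success_le)
  also have "\<dots> = 2 / k * ((\<Sum>P\<in>?T. \<Sum>b<k. planted (P ` {..<k}) (found (P b))) + card ?T * (N / Q))"
    by (simp only: sum_distrib_left[symmetric] sum.distrib sum_constant)
  also have "\<dots> \<le> 2 / k * (card ?T * ((2 * k + 2 * ?\<epsilon>) / m) + card ?T * (N / Q))"
    using found by (intro mult_left_mono add_right_mono) auto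
  also have "\<dots> = card ?T * (2 / k * ((2 * k + 2 * ?\<epsilon>) / m + N / Q))"
    by (simp only: distrib_left[symmetric] mult.left_commute)
  finally show ?thesis .
qed

end

text \<open>Averaging over uniform \<open>P\<close>, \<open>u\<close>, \<open>x\<close> and
  \<open>y\<close>. The instances have entries in {-1, 0, 1}, which lie within every bound
  \<open>B \<ge> 1\<close>.\<close>

lemma (in hard_instance) exists_successful_algorithm:
  assumes Q: "Q > 0" and B: "B \<ge> 1"
    and solves: "solves_volume_max R p (bounded_int_mats n d B) (2 * k) ((16 / 15) ^ k) \<delta>"
  shows "\<exists>D\<in>set_pmf R. \<delta> * card (transversals k N) \<le>
    (\<Sum>P\<in>transversals k N. code_space.planted N Q (P ` {..<k})
      (\<lambda>x y. of_bool (approx_output (inst x y) (2 * k) ((16 / 15) ^ k) (run D p (inst x y)))))"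
proof -
  interpret code_space N Q by unfold_locales (rule Q)
  let ?T = "transversals k N"
  define ok where "ok D = (\<lambda>(P, u, x, y).
    approx_output (inst (override (P ` {..<k}) u x) (override (P ` {..<k}) u y)) (2 * k) ((16 / 15) ^ k)
      (run D p (inst (override (P ` {..<k}) u x) (override (P ` {..<k}) u y))))" for D
  have "\<exists>D\<in>set_pmf R. \<delta> * card (?T \<times> cube \<times> cube \<times> cube)
      \<le> (\<Sum>\<omega>\<in>?T \<times> cube \<times> cube \<times> cube. of_bool (ok D \<omega>))"
  proof (rule pmf_averaging)
    fix \<omega> assume "\<omega> \<in> ?T \<times> cube \<times> cube \<times> cube"
    then obtain P u x y where \<omega>: "\<omega> = (P, u, x, y)" "u \<in> cube" "x \<in> cube" "y \<in> cube"
      by auto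
    have "inst (override (P ` {..<k}) u x) (override (P ` {..<k}) u y) \<in> bounded_int_mats n d B"
      by (intro inst_bounded B) (use \<omega> in \<open>simp_all add: cube_less override_in_cube\<close>)
    then show "measure_pmf.prob R {D. ok D \<omega>} \<ge> \<delta>"
      using solves by (auto simp: solves_volume_max_def ok_def \<omega>(1))
  qed auto
  then obtain D where D: "D \<in> set_pmf R"
    and le: "\<delta> * card (?T \<times> cube \<times> cube \<times> cube)
      \<le> (\<Sum>\<omega>\<in>?T \<times> cube \<times> cube \<times> cube. of_bool (ok D \<omega>))"
    by blast
  let ?f = "\<lambda>x y. of_bool (approx_output (inst x y) (2 * k) ((16 / 15) ^ k) (run D p (inst x y))) :: real"
  have "(\<Sum>\<omega>\<in>?T \<times> cube \<times> cube \<times> cube. of_bool (ok D \<omega>))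
      = (\<Sum>P\<in>?T. \<Sum>u\<in>cube. \<Sum>x\<in>cube. \<Sum>y\<in>cube.
          ?f (override (P ` {..<k}) u x) (override (P ` {..<k}) u y))"
    by (simp only: sum.cartesian_product split_def ok_def)
  also have "\<dots> = (\<Sum>P\<in>?T. real (card cube) ^ 3 * planted (P ` {..<k}) ?f)"
    by (simp add: planted_def mean_def sum_divide_distrib[symmetric] power3_eq_cube)
  finally have "real (card cube) ^ 3 * (\<delta> * card ?T)
      \<le> real (card cube) ^ 3 * (\<Sum>P\<in>?T. planted (P ` {..<k}) ?f)"
    using le by (simp add: card_cartesian_product power3_eq_cube sum_distrib_left algebra_simps)
  moreover have "real (card cube) ^ 3 > 0"
    using card_cube_pos by simp
  ultimately have "\<delta> * card ?T \<le> (\<Sum>P\<in>?T. planted (P ` {..<k}) ?f)"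
    by (rule mult_left_le_imp_le)
  with D show ?thesis by blast
qed

theorem mainTheorem13:
  fixes p a :: nat and C :: real
  assumes "p \<ge> 1" and "C = 16 / 15"
  shows "\<exists>c>0. \<exists>K. \<forall>k n. k \<ge> 1 \<and> n \<ge> K * k \<longrightarrow>
           (\<exists>d. \<forall>R s.
              uses_bits R s \<and>
              solves_volume_max R p (bounded_int_mats n d (n ^ a)) (2 * k) (C ^ k) (8 / 9)
              \<longrightarrow> real s \<ge> c * real n)"
proof (rule exI[of _ "1 / (6400 * real p)"], rule conjI[rotated],
    rule exI[of _ "80 :: nat"], intro allI impI)
  show "0 < 1 / (6400 * real p)" using assms(1) by simp
  fix k n :: nat assume kn: "1 \<le> k \<and> 80 * k \<le> n"
  \<comment> \<open>\<open>m\<close> is the class size. The factor 80 gives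
    \<open>m \<ge> 40\<close>, and rounding down loses little: \<open>n \<le> 4 * N\<close>.\<close>
  define m where "m = n div (2 * k)"
  define N where "N = k * m"
  \<comment> \<open>Makes the expected number of accidental hits at most 1/40.\<close>
  define Q where "Q = 40 * N"
  have m40: "40 \<le> m"
    using kn by (simp add: m_def less_eq_div_iff_mult_less_eq)
  then have pos: "k > 0" "m > 0" "N > 0" "Q > 0"
    using kn by (auto simp: N_def Q_def)
  have "2 * N \<le> n"
    using div_times_less_eq_dividend[of n "2 * k"] by (simp add: N_def m_def algebra_simps)
  interpret hard_instance k N Q n
    by unfold_locales fact+
  have "n < 2 * k * (m + 1)"
    using dividend_less_div_times[of "2 * k" n] pos by (simp add: m_def algebra_simps)
  also have "\<dots> \<le> 2 * k * (m + m)"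
    using pos by (intro mult_left_mono) auto
  finally have n_le: "n \<le> 4 * N" by (simp add: N_def algebra_simps)
  show "\<exists>d. \<forall>R s. uses_bits R s \<and>
      solves_volume_max R p (bounded_int_mats n d (n ^ a)) (2 * k) (C ^ k) (8 / 9)
      \<longrightarrow> 1 / (6400 * real p) * real n \<le> real s"
  proof (rule exI[of _ d], intro allI impI, rule ccontr)
    fix R s
    assume alg: "uses_bits R s \<and>
      solves_volume_max R p (bounded_int_mats n d (n ^ a)) (2 * k) (C ^ k) (8 / 9)"
      and "\<not> 1 / (6400 * real p) * real n \<le> real s"
    then have ps: "6400 * (real p * real s) < n"
      using assms(1) by (simp add: field_simps)
    have "n ^ a \<ge> 1" using kn by simp
    then obtain D where D: "D \<in> set_pmf R" and
      succ: "8 / 9 * card (transversals k N) \<le>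
        (\<Sum>P\<in>transversals k N. code_space.planted N Q (P ` {..<k})
          (\<lambda>x y. of_bool (approx_output (inst x y) (2 * k) ((16 / 15) ^ k) (run D p (inst x y)))))"
      using exists_successful_algorithm[OF pos(4), of "n ^ a" R p "8 / 9"] alg assms(2) by blast
    interpret S: hard_stream k N Q n D p s
      using alg D pos assms(1) by unfold_locales (auto simp: uses_bits_def)
    have "8 / 9 * card (transversals k N) \<le> (\<Sum>P\<in>transversals k N. S.planted (P ` {..<k}) S.success)"
      using succ by (simp add: S.success_def[abs_def])
    \<comment> \<open>\<delta> = 1/20 balances the two halves of the exchange cost: the part linear
      in \<delta> and, by \<open>6400 * p * s < n \<le> 4 * N\<close>, the part with
      \<open>s\<close> come to at most \<open>k / 5\<close> each.\<close>
    also have "\<dots> \<le> card (transversals k N) *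
        (2 / k * ((2 * k + 2 * (1 / 20 * N + 4 * p * s / (1 / 20))) / m + N / Q))"
      by (rule S.sum_planted_success_le) (use pos N_def in auto)
    finally have "card (transversals k N) * (8 / 9) \<le> card (transversals k N) *
        (2 / k * ((2 * k + 2 * (1 / 20 * N + 4 * p * s / (1 / 20))) / m + N / Q))"
      by (simp only: mult.commute)
    moreover have "real (card (transversals k N)) > 0"
      using transversals_nonempty[OF pos(2), of k] by (simp add: N_def card_gt_0_iff)
    ultimately have "8 / 9 \<le> 2 / k * ((2 * k + 2 * (1 / 20 * N + 4 * p * s / (1 / 20))) / m + N / Q)"
      by (rule mult_left_le_imp_le)
    then have "8 / 9 * k \<le> 2 * ((2 * k + 2 * (1 / 20 * N + 80 * (real p * real s))) / m + N / Q)"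
      using pos by (simp add: field_simps)
    \<comment> \<open>The four terms are guessing (\<open>k / 10\<close>), the two exchange costs
      (\<open>k / 5\<close> each) and accidental hits (1/20). Their sum is at most
      \<open>0.55 * k\<close>, below \<open>8 / 9 * k\<close>.\<close>
    also have "\<dots> = 4 * (k / m) + N / m / 5 + 320 * (real p * real s) / m + 2 * (N / Q)"
      using pos by (simp add: field_simps)
    also have "N / m = real k" using pos by (simp add: N_def)
    also have "N / Q = 1 / 40" using pos by (simp add: Q_def)
    also have "320 * (real p * real s) / m \<le> k / 5"
    proof -
      have "320 * (real p * real s) \<le> N / 5" using ps n_le by simp
      then show ?thesis using pos by (simp add: N_def field_simps)
    qed
    also have "k / m \<le> k / 40"
      using m40 pos by (intro divide_left_mono) auto
    finally have "8 / 9 * real k \<le> k / 10 + k / 5 + k / 5 + 1 / 20" by simp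
    then show False using pos(1) by simp
  qed
qed

end
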